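(* Let $m>1$, $N\ge2$, and $\chi=C_N$. Let $X_0\in\mathcal R^N$ and let $X$ be the maximal solution in $\mathcal R^N$ of the gradient flow system with $X(0)=X_0$. Then the maximal time of existence of $X$ is $T=+\infty$. Moreover, if $|X(t)|$ is uniformly bounded in $t$, then $Y(t)=X(t)/|X(t)|$ converges as $t\to\infty$ to the unique critical point of $\mathcal F^N_m$ in $\mathcal R^N$ with unit Euclidean norm.
   Context: $\mathcal R^N=\{X\in\mathbb R^N: X_1<\dots<X_N,\ \sum_iX_i=0\}$. $\mathcal F^N_m(X)=\frac1{m-1}\sum_{i=1}^{N-1}(X_{i+1}-X_i)^{1-m}-\frac{\chi}{m-1}\sum_{1\le i\ne j\le N}|X_i-X_j|^{1-m}$. $C_N>0$ is defined by $\frac1{C_N}=\max_{X\in\mathcal R^N}\frac{\sum_{1\le i\ne j\le N}|X_j-X_i|^{1-m}}{\sum_{i=1}^{N-1}(X_{i+1}-X_i)^{1-m}}$. Gradient flow system: for $i=1,\dots,N$, $\dot X_i=-(X_{i+1}-X_i)^{-m}+(X_i-X_{i-1})^{-m}+2\chi\sum_{j\ne i}\mathrm{sign}(j-i)|X_j-X_i|^{-m}$, the first term being absent for $i=N$ and the second for $i=1$ (i.e. $\dot X=-\nabla\mathcal F^N_m(X)$). *)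

theory Defs
  imports "HOL-Analysis.Analysis"
begin

text \<open>Vectors of R^N are represented as functions nat => real indexed by 1..N,
  required to vanish outside {1..N}.\<close>

definition inRN :: "nat \<Rightarrow> (nat \<Rightarrow> real) \<Rightarrow> bool" where
  "inRN N X \<longleftrightarrow> (\<forall>i. i \<notin> {1..N} \<longrightarrow> X i = 0)
      \<and> (\<forall>i\<in>{1..<N}. X i < X (Suc i))
      \<and> (\<Sum>i=1..N. X i) = 0"

definition enorm :: "nat \<Rightarrow> (nat \<Rightarrow> real) \<Rightarrow> real" where
  "enorm N X = sqrt (\<Sum>i=1..N. (X i)\<^sup>2)"

definition FNm :: "nat \<Rightarrow> real \<Rightarrow> real \<Rightarrow> (nat \<Rightarrow> real) \<Rightarrow> real" where
  "FNm N m chi X =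
     1 / (m - 1) * (\<Sum>i=1..<N. (X (Suc i) - X i) powr (1 - m))
     - chi / (m - 1) * (\<Sum>i=1..N. \<Sum>j\<in>{1..N} - {i}. \<bar>X i - X j\<bar> powr (1 - m))"

definition ratioN :: "nat \<Rightarrow> real \<Rightarrow> (nat \<Rightarrow> real) \<Rightarrow> real" where
  "ratioN N m X =
     (\<Sum>i=1..N. \<Sum>j\<in>{1..N} - {i}. \<bar>X j - X i\<bar> powr (1 - m))
     / (\<Sum>i=1..<N. (X (Suc i) - X i) powr (1 - m))"

text \<open>1 / C_N is the maximum of the ratio over R^N (written as the supremum).\<close>
definition CN :: "nat \<Rightarrow> real \<Rightarrow> real" where
  "CN N m = 1 / (SUP X\<in>{X. inRN N X}. ratioN N m X)"

text \<open>Right-hand side of the gradient flow system (= minus the gradient of F).\<close>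
definition velocity :: "nat \<Rightarrow> real \<Rightarrow> real \<Rightarrow> (nat \<Rightarrow> real) \<Rightarrow> nat \<Rightarrow> real" where
  "velocity N m chi X i =
     (if i < N then - ((X (Suc i) - X i) powr (- m)) else 0)
     + (if 1 < i then (X i - X (i - 1)) powr (- m) else 0)
     + 2 * chi * (\<Sum>j\<in>{1..N} - {i}. sgn (real j - real i) * \<bar>X j - X i\<bar> powr (- m))"

definition critical_point :: "nat \<Rightarrow> real \<Rightarrow> real \<Rightarrow> (nat \<Rightarrow> real) \<Rightarrow> bool" where
  "critical_point N m chi Z \<longleftrightarrow>
     (\<forall>i\<in>{1..N}. ((\<lambda>h. FNm N m chi (Z(i := Z i + h))) has_real_derivative 0) (at 0))"

definition is_solution ::
  "nat \<Rightarrow> real \<Rightarrow> real \<Rightarrow> (nat \<Rightarrow> real) \<Rightarrow> (real \<Rightarrow> nat \<Rightarrow> real) \<Rightarrow> ereal \<Rightarrow> bool" where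
  "is_solution N m chi X0 X T \<longleftrightarrow> 0 < T \<and> X 0 = X0 \<and>
     (\<forall>t. 0 \<le> t \<and> ereal t < T \<longrightarrow> inRN N (X t) \<and>
        (\<forall>i\<in>{1..N}. ((\<lambda>s. X s i) has_real_derivative velocity N m chi (X t) i)
                        (at t within {s. 0 \<le> s \<and> ereal s < T})))"

definition is_maximal_solution ::
  "nat \<Rightarrow> real \<Rightarrow> real \<Rightarrow> (nat \<Rightarrow> real) \<Rightarrow> (real \<Rightarrow> nat \<Rightarrow> real) \<Rightarrow> ereal \<Rightarrow> bool" where
  "is_maximal_solution N m chi X0 X T \<longleftrightarrow> is_solution N m chi X0 X T \<and>
     \<not> (\<exists>X' T'. T < T' \<and> is_solution N m chi X0 X' T' \<and>
            (\<forall>t. 0 \<le> t \<and> ereal t < T \<longrightarrow> X' t = X t))"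

end

theory Submission
  imports Defs "HOL-Probability.Discrete_Topology"
begin

text \<open>
  With \<open>u k = (X (k + 1) - X k) powr (1 - m)\<close> the nearest-neighbour part of \<open>F\<close>
  is linear and the interaction is a sum of power means, concave and 1-homogeneous in \<open>u\<close>.
  Hence for the critical \<open>chi\<close> the function \<open>F\<close> is nonnegative, its
  critical points are exactly its zeros, and strict concavity makes them unique up to dilation.
  Maximisers of the ratio on the closed simplex of normalised \<open>u\<close> lie in the interior,
  so a bound on \<open>F\<close> from above and on the norm from below keeps all gaps away from
  zero. Both bounds persist along the flow, as \<open>F\<close> decreases and
  \<open>enorm\<^sup>2\<close> has derivative \<open>2 (m - 1) F\<close>, which is nonnegative; so
  the flow is global. If it is bounded, then \<open>F\<close> tends to 0 and every limit point is a
  zero of \<open>F\<close>.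
\<close>

section \<open>Ordinary differential equations\<close>

text \<open>The obstacle is that the supremum in \<open>CN\<close> runs over an open cone, so
  nothing a priori keeps nearly optimal configurations from degenerating. In the variables
  \<open>u\<close> it becomes a homogeneous inequality that extends to the closed orthant once the
  power means are continued by 0 to the boundary; there compactness is available, and excluding
  boundary maximisers brings the limits back to genuine configurations. The exponent
  \<open>p = m - 1\<close> is forced: \<open>u k powr (- (1 / p))\<close> is again the gap, so its
  sum over a block of neighbours telescopes to a distance. \<open>F\<close> is homogeneous of degree
  \<open>1 - m\<close>, and Euler's identity does double duty: it makes \<open>F\<close> vanish at
  critical points and gives the derivative of \<open>enorm\<^sup>2\<close>. The velocity is singular
  at collisions, so the flow is built from a globally Lipschitz truncation whose cutoff comes from
  the gap bound. The critical point in the conclusion is produced by the bounded flow itself, as a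
  normalised limit point.\<close>

lemma bounded_coordinates_convergent_subsequence:
  fixes f :: "nat \<Rightarrow> 'a \<Rightarrow> real"
  assumes "finite J" and "\<And>n j. j \<in> J \<Longrightarrow> \<bar>f n j\<bar> \<le> C"
  shows "\<exists>l s. strict_mono (s :: nat \<Rightarrow> nat) \<and> (\<forall>j\<in>J. (\<lambda>n. f (s n) j) \<longlonglongrightarrow> l j)"
  using assms
proof (induction J rule: finite_induct)
  case empty
  have "strict_mono (id :: nat \<Rightarrow> nat)" by (simp add: strict_mono_def)
  then show ?case by blast
next
  case (insert k J)
  then obtain l and s :: "nat \<Rightarrow> nat"
    where s: "strict_mono s" and l: "\<forall>j\<in>J. (\<lambda>n. f (s n) j) \<longlonglongrightarrow> l j"
    by (metis insert_iff)
  have "bounded (range (\<lambda>n. f (s n) k))"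
    unfolding bounded_iff using insert.prems by auto
  then obtain c and r :: "nat \<Rightarrow> nat"
    where r: "strict_mono r" and c: "((\<lambda>n. f (s n) k) \<circ> r) \<longlonglongrightarrow> c"
    using bounded_imp_convergent_subsequence by blast
  have "\<forall>j\<in>insert k J. (\<lambda>n. f ((s \<circ> r) n) j) \<longlonglongrightarrow> (l(k := c)) j"
  proof
    fix j assume "j \<in> insert k J"
    then consider "j = k" | "j \<in> J" "j \<noteq> k" by auto
    then show "(\<lambda>n. f ((s \<circ> r) n) j) \<longlonglongrightarrow> (l(k := c)) j"
    proof cases
      case 1
      then show ?thesis using c by (simp add: o_def)
    next
      case 2
      then have "(\<lambda>n. f (s n) j) \<longlonglongrightarrow> l j" using l by blast
      from LIMSEQ_subseq_LIMSEQ[OF this r] show ?thesis using 2 by (simp add: o_def)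
    qed
  qed
  moreover have "strict_mono (s \<circ> r)" using s r by (rule strict_mono_o)
  ultimately show ?case by blast
qed

lemma has_integral_exp_scaled:
  fixes a t :: real
  assumes "a \<noteq> 0" "0 \<le> t"
  shows "((\<lambda>s. exp (a * s)) has_integral (exp (a * t) - 1) / a) {0..t}"
proof -
  have "((\<lambda>s. exp (a * s)) has_integral (exp (a * t) / a - exp (a * 0) / a)) {0..t}"
    using assms by (intro fundamental_theorem_of_calculus)
      (auto intro!: derivative_eq_intros simp flip: has_real_derivative_iff_has_vector_derivative)
  then show ?thesis by (simp add: diff_divide_distrib)
qed

text \<open>Integrating \<open>exp (a * s)\<close> gains a factor \<open>1 / a\<close>, and the
  outer weight cancels the growth. This gain turns the Lipschitz constant \<open>L\<close> into the
  contraction constant \<open>L / a\<close>.\<close>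

lemma norm_integral_exp_bound:
  fixes h :: "real \<Rightarrow> 'a::banach" and a t C :: real
  assumes "a > 0" "0 \<le> t" "0 \<le> C" "continuous_on {0..t} h"
    and "\<And>s. s \<in> {0..t} \<Longrightarrow> norm (h s) \<le> C * exp (a * s)"
  shows "norm (exp (- a * t) *\<^sub>R integral {0..t} h) \<le> C / a"
proof -
  have int: "((\<lambda>s. C * exp (a * s)) has_integral C * ((exp (a * t) - 1) / a)) {0..t}"
    using has_integral_exp_scaled[of a t] assms by (intro has_integral_mult_right) auto
  have "norm (integral {0..t} h) \<le> integral {0..t} (\<lambda>s. C * exp (a * s))"
    using assms int by (intro integral_norm_bound_integral integrable_continuous_real) (auto intro!: continuous_intros)
  also have "\<dots> = C * ((exp (a * t) - 1) / a)" using int by (rule integral_unique)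
  also have "\<dots> \<le> C * (exp (a * t) / a)"
    using assms by (intro mult_left_mono divide_right_mono) auto
  finally have "exp (- a * t) * norm (integral {0..t} h) \<le> exp (- a * t) * (C * (exp (a * t) / a))"
    by (intro mult_left_mono) auto
  also have "\<dots> = C / a" by (simp add: exp_minus field_simps)
  finally show ?thesis by simp
qed

text \<open>The unknown \<open>x\<close> is rescaled to \<open>exp (- a t) (x t - x0)\<close> with \<open>a > L\<close>; in this weighted
  norm the Picard operator is a contraction on the whole half line.\<close>

lemma global_solution_of_lipschitz_ode:
  fixes f :: "'a::banach \<Rightarrow> 'a"
  assumes L: "0 \<le> L" and lip: "\<And>x y. norm (f x - f y) \<le> L * norm (x - y)"
  shows "\<exists>x. x 0 = x0 \<and> (\<forall>t\<ge>0. (x has_vector_derivative f (x t)) (at t within {0..}))"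
proof -
  \<comment> \<open>Any rate above \<open>L\<close> would do; only \<open>L / a < 1\<close>
    matters.\<close>
  define a where "a = L + 1"
  have a: "a > 0" using L by (simp add: a_def)
  have contf: "continuous_on UNIV f"
  proof (rule lipschitz_on_continuous_on)
    show "L-lipschitz_on UNIV f" using lip L by (auto simp: lipschitz_on_def dist_norm)
  qed
  define h where "h = (\<lambda>y s. f (x0 + exp (a * s) *\<^sub>R apply_bcontfun (y :: real \<Rightarrow>\<^sub>C 'a) s))"
  have conth: "continuous_on A (h y)" for A y
    unfolding h_def
    by (rule continuous_on_compose2[OF contf]) (auto intro!: continuous_intros)
  define C where "C = (\<lambda>y :: real \<Rightarrow>\<^sub>C 'a. norm (f x0) + L * norm y)"
  have hbound: "norm (h y s) \<le> C y * exp (a * s)" if "0 \<le> s" for y s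
  proof -
    have e1: "1 \<le> exp (a * s)" using a that by simp
    have "norm (h y s) \<le> norm (f x0) + norm (h y s - f x0)" by (metis add.commute norm_diff_triangle_le norm_minus_commute order_refl diff_add_cancel norm_triangle_ineq)
    also have "norm (h y s - f x0) \<le> L * (exp (a * s) * norm (apply_bcontfun y s))"
      unfolding h_def using lip[of "x0 + exp (a * s) *\<^sub>R apply_bcontfun y s" x0] by simp
    also have "\<dots> \<le> L * (exp (a * s) * norm y)"
      using L by (intro mult_left_mono norm_bounded) auto
    also have "norm (f x0) + \<dots> \<le> norm (f x0) * exp (a * s) + L * (exp (a * s) * norm y)"
      using e1 by (simp add: mult_le_cancel_left1)
    finally show ?thesis by (simp add: C_def algebra_simps)
  qed
  have C0: "0 \<le> C y" for y unfolding C_def using L by simp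
  \<comment> \<open>The fixed point is sought among bounded continuous functions on the whole real
    line. Replacing \<open>t\<close> by \<open>max 0 t\<close> extends the Picard operator
    continuously by 0 to negative times.\<close>
  define G where "G = (\<lambda>y t. exp (- a * max 0 t) *\<^sub>R integral {0..max 0 t} (h y))"
  have intcont: "continuous_on {0..b} (\<lambda>t. integral {0..t} (h y))" for b y
    by (intro indefinite_integral_continuous_1 integrable_continuous_real conth)
  have contG: "continuous_on UNIV (G y)" for y
  proof -
    have "continuous_on {0..} (\<lambda>t. integral {0..t} (h y))"
      unfolding continuous_on_eq_continuous_within
    proof
      fix t :: real assume t: "t \<in> {0..}"
      have "continuous (at t within {0..t+1}) (\<lambda>t. integral {0..t} (h y))"
        using intcont[of "t+1" y] t by (simp add: continuous_on_eq_continuous_within)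
      moreover have "at t within {0..} = at t within {0..t+1}"
        by (rule at_within_nhd[of _ "{..<t+1}"]) (use t in auto)
      ultimately show "continuous (at t within {0..}) (\<lambda>t. integral {0..t} (h y))" by simp
    qed
    then have "continuous_on UNIV (\<lambda>t. integral {0..max 0 t} (h y))"
      by (rule continuous_on_compose2[where f = "max 0"]) (auto intro!: continuous_intros)
    then show ?thesis unfolding G_def by (intro continuous_intros)
  qed
  have Gb: "norm (G y t) \<le> C y / a" for y t
    unfolding G_def
    by (rule norm_integral_exp_bound) (use a C0 hbound conth in auto)
  have GB: "G y \<in> bcontfun" for y using contG Gb by (rule bcontfun_normI)
  define P where "P = (\<lambda>y. Bcontfun (G y))"
  have P: "apply_bcontfun (P y) = G y" for y unfolding P_def using GB by (rule Bcontfun_inverse)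
  have contr: "dist (P y) (P z) \<le> L / a * dist y z" for y z
  proof (rule dist_bound)
    fix t :: real
    have "dist (G y t) (G z t) = norm (exp (- a * max 0 t) *\<^sub>R integral {0..max 0 t} (\<lambda>s. h y s - h z s))"
      unfolding G_def dist_norm
      by (subst integral_diff) (auto intro!: integrable_continuous_real conth simp: scaleR_diff_right)
    also have "\<dots> \<le> (L * dist y z) / a"
    proof (rule norm_integral_exp_bound)
      fix s assume s: "s \<in> {0..max 0 t}"
      have "norm (h y s - h z s) \<le> L * norm (exp (a * s) *\<^sub>R (apply_bcontfun y s - apply_bcontfun z s))"
        unfolding h_def by (rule order_trans[OF lip]) (simp add: scaleR_diff_right)
      also have "\<dots> \<le> L * (exp (a * s) * dist y z)"
        using L dist_bounded[of y s z] by (intro mult_left_mono) (auto simp: dist_norm intro!: mult_left_mono)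
      finally show "norm (h y s - h z s) \<le> L * dist y z * exp (a * s)" by (simp add: mult_ac)
    qed (use a L conth in \<open>auto intro!: continuous_intros\<close>)
    finally show "dist (apply_bcontfun (P y) t) (apply_bcontfun (P z) t) \<le> L / a * dist y z"
      by (simp add: P)
  qed
  have "\<exists>!y. P y = y"
    by (rule banach_fix_type[where c = "L / a"]) (use L a contr in \<open>auto simp: a_def\<close>)
  then obtain y where y: "P y = y" by auto
  define x where "x = (\<lambda>t. x0 + exp (a * t) *\<^sub>R apply_bcontfun y t)"
  have x_eq: "x t = x0 + integral {0..t} (h y)" if "0 \<le> t" for t
  proof -
    have "apply_bcontfun y t = G y t" using P[of y] y by simp
    then show ?thesis unfolding x_def G_def using that by (simp flip: exp_add)
  qed
  have "(x has_vector_derivative f (x t)) (at t within {0..})" if t: "t \<ge> 0" for t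
  proof -
    have "((\<lambda>u. integral {0..u} (h y)) has_vector_derivative h y t) (at t within {0..t+1})"
      by (rule integral_has_vector_derivative) (use t conth in auto)
    moreover have "at t within {0..} = at t within {0..t+1}"
      by (rule at_within_nhd[of _ "{..<t+1}"]) (use t in auto)
    ultimately have "((\<lambda>u. x0 + integral {0..u} (h y)) has_vector_derivative f (x t)) (at t within {0..})"
      by (auto intro!: derivative_eq_intros simp: h_def x_def)
    then show ?thesis
      by (rule has_vector_derivative_transform[rotated 2]) (use t x_eq in auto)
  qed
  moreover have "x 0 = x0" using x_eq[of 0] by simp
  ultimately show ?thesis by blast
qed

text \<open>The Gronwall argument: the squared distance of two solutions, damped by
  \<open>exp (- 2 K t)\<close>, is nonincreasing.\<close>

lemma lipschitz_ode_unique: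
  fixes f :: "('a \<Rightarrow> real) \<Rightarrow> 'a \<Rightarrow> real" and x y :: "real \<Rightarrow> 'a \<Rightarrow> real"
  assumes J: "finite J" and L: "0 \<le> L"
    and lip: "\<And>u v i. i \<in> J \<Longrightarrow> \<bar>f u i - f v i\<bar> \<le> L * (\<Sum>j\<in>J. \<bar>u j - v j\<bar>)"
    and t: "0 \<le> t"
    and x: "\<And>s i. 0 \<le> s \<Longrightarrow> s \<le> t \<Longrightarrow> i \<in> J \<Longrightarrow>
              ((\<lambda>r. x r i) has_real_derivative f (x s) i) (at s within {0..t})"
    and y: "\<And>s i. 0 \<le> s \<Longrightarrow> s \<le> t \<Longrightarrow> i \<in> J \<Longrightarrow>
              ((\<lambda>r. y r i) has_real_derivative f (y s) i) (at s within {0..t})"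
    and init: "\<And>i. i \<in> J \<Longrightarrow> x 0 i = y 0 i" and i: "i \<in> J"
  shows "x t i = y t i"
proof -
  \<comment> \<open>The Lipschitz hypothesis is in the sum norm, the argument in the Euclidean one;
    Cauchy-Schwarz costs the factor \<open>card J\<close>.\<close>
  define K where "K = L * real (card J)"
  define D where "D = (\<lambda>s. exp (- (2 * K) * s) * (\<Sum>i\<in>J. (x s i - y s i)\<^sup>2))"
  define D' where "D' = (\<lambda>s. exp (- (2 * K) * s) *
      ((\<Sum>i\<in>J. 2 * (x s i - y s i) * (f (x s) i - f (y s) i)) - 2 * K * (\<Sum>i\<in>J. (x s i - y s i)\<^sup>2)))"
  have der: "(D has_real_derivative D' s) (at s within {0..t})" if "0 \<le> s" "s \<le> t" for s
    unfolding D_def D'_def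
    by (rule derivative_eq_intros x y that refl | assumption)+
       (simp add: algebra_simps sum_distrib_left sum_subtractf)
  have le: "D' s \<le> 0" for s
  proof -
    let ?w = "\<lambda>i. \<bar>x s i - y s i\<bar>"
    have "(\<Sum>i\<in>J. 2 * (x s i - y s i) * (f (x s) i - f (y s) i)) \<le> (\<Sum>i\<in>J. 2 * ?w i * (L * (\<Sum>j\<in>J. ?w j)))"
    proof (rule sum_mono)
      fix i assume i: "i \<in> J"
      have "2 * (x s i - y s i) * (f (x s) i - f (y s) i) \<le> 2 * \<bar>(x s i - y s i) * (f (x s) i - f (y s) i)\<bar>"
        using abs_ge_self[of "(x s i - y s i) * (f (x s) i - f (y s) i)"] by linarith
      also have "\<dots> = 2 * ?w i * \<bar>f (x s) i - f (y s) i\<bar>" by (simp add: abs_mult)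
      also have "\<dots> \<le> 2 * ?w i * (L * (\<Sum>j\<in>J. ?w j))"
        using lip[OF i] by (intro mult_left_mono) auto
      finally show "2 * (x s i - y s i) * (f (x s) i - f (y s) i) \<le> 2 * ?w i * (L * (\<Sum>j\<in>J. ?w j))" .
    qed
    also have "\<dots> = 2 * L * (\<Sum>j\<in>J. ?w j)\<^sup>2"
      by (simp add: power2_eq_square sum_distrib_left sum_distrib_right mult_ac)
    also have "\<dots> \<le> 2 * L * (real (card J) * (\<Sum>j\<in>J. (?w j)\<^sup>2))"
    proof -
      have "(\<Sum>j\<in>J. ?w j * 1)\<^sup>2 \<le> (\<Sum>j\<in>J. (?w j)\<^sup>2) * (\<Sum>j\<in>J. 1\<^sup>2)"
        by (rule Cauchy_Schwarz_ineq_sum)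
      then show ?thesis using L by (intro mult_left_mono) (auto simp: mult.commute)
    qed
    finally show ?thesis unfolding D'_def K_def
      by (intro mult_nonneg_nonpos) (auto simp: mult_ac)
  qed
  have "D t \<le> D 0"
  proof (rule DERIV_nonpos_imp_decreasing_open[OF t])
    fix s assume s: "0 < s" "s < t"
    then have "(D has_real_derivative D' s) (at s)"
      using der[of s] at_within_Icc_at[of 0 s t] by simp
    then show "\<exists>y. (D has_real_derivative y) (at s) \<and> y \<le> 0" using le by blast
  next
    show "continuous_on {0..t} D"
      by (rule DERIV_continuous_on[of _ _ D']) (use der in auto)
  qed
  also have "D 0 = 0" unfolding D_def using init by simp
  finally have "(\<Sum>i\<in>J. (x t i - y t i)\<^sup>2) \<le> 0"
    unfolding D_def by (simp add: mult_le_0_iff not_le[symmetric])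
  moreover have "(x t i - y t i)\<^sup>2 \<le> (\<Sum>i\<in>J. (x t i - y t i)\<^sup>2)"
    using J i by (intro member_le_sum) auto
  ultimately have "(x t i - y t i)\<^sup>2 \<le> 0" by linarith
  then show ?thesis by simp
qed

section \<open>Power means with negative exponent\<close>

text \<open>An unnormalised power mean of exponent \<open>- 1 / p\<close>. The value 0 in the
  presence of a nonpositive entry is its continuous extension to the boundary of the positive
  orthant, where configurations with degenerate normalised gap powers live.\<close>

definition power_mean :: "real \<Rightarrow> 'a set \<Rightarrow> ('a \<Rightarrow> real) \<Rightarrow> real" where
  "power_mean p I u = (if \<exists>k\<in>I. u k \<le> 0 then 0 else (\<Sum>k\<in>I. u k powr (- (1 / p))) powr (- p))"

lemma power_mean_pos_eq:
  "(\<And>k. k \<in> I \<Longrightarrow> 0 < u k) \<Longrightarrow> power_mean p I u = (\<Sum>k\<in>I. u k powr (- (1 / p))) powr (- p)"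
  by (force simp: power_mean_def)

lemma power_mean_nonneg: "0 \<le> power_mean p I u"
  by (simp add: power_mean_def)

lemma power_mean_le:
  assumes "0 < p" "finite I" "k \<in> I" "0 \<le> u k"
  shows "power_mean p I u \<le> u k"
proof (cases "\<exists>k\<in>I. u k \<le> 0")
  case True
  then show ?thesis using assms by (simp add: power_mean_def)
next
  case False
  then have pos: "\<And>k. k \<in> I \<Longrightarrow> 0 < u k" by force
  have "u k powr (- (1 / p)) \<le> (\<Sum>k\<in>I. u k powr (- (1 / p)))"
    using assms by (intro member_le_sum) auto
  then have "(\<Sum>k\<in>I. u k powr (- (1 / p))) powr (- p) \<le> (u k powr (- (1 / p))) powr (- p)"
    using assms pos[of k] by (intro powr_mono2') auto
  also have "\<dots> = u k" using assms pos[of k] by (simp add: powr_powr)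
  finally show ?thesis using power_mean_pos_eq[of I u p] pos by simp
qed

lemma power_mean_mono:
  assumes "0 < p" "finite I" "\<And>k. k \<in> I \<Longrightarrow> u k \<le> v k"
  shows "power_mean p I u \<le> power_mean p I v"
proof (cases "I = {} \<or> (\<exists>k\<in>I. u k \<le> 0)")
  case True
  then show ?thesis by (auto simp: power_mean_def)
next
  case False
  then have pos: "\<And>k. k \<in> I \<Longrightarrow> 0 < u k" and ne: "I \<noteq> {}" by force+
  then have pos': "\<And>k. k \<in> I \<Longrightarrow> 0 < v k" using assms(3) by force
  have "(\<Sum>k\<in>I. v k powr (- (1 / p))) \<le> (\<Sum>k\<in>I. u k powr (- (1 / p)))"
    using assms pos by (intro sum_mono powr_mono2') auto
  moreover have "0 < (\<Sum>k\<in>I. v k powr (- (1 / p)))"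
    using assms(2) ne pos' by (intro sum_pos) (auto simp: less_le)
  ultimately show ?thesis
    using assms(1) by (simp add: power_mean_pos_eq pos pos' powr_mono2')
qed

lemma power_mean_scale:
  assumes "0 < p" "0 < c" "\<And>k. k \<in> I \<Longrightarrow> 0 < u k"
  shows "power_mean p I (\<lambda>k. c * u k) = c * power_mean p I u"
proof -
  have "(\<Sum>k\<in>I. (c * u k) powr (- (1 / p))) = c powr (- (1 / p)) * (\<Sum>k\<in>I. u k powr (- (1 / p)))"
    unfolding sum_distrib_left using assms by (intro sum.cong) (auto simp: powr_mult less_imp_le)
  then show ?thesis
    using assms by (simp add: power_mean_pos_eq powr_mult powr_powr sum_nonneg)
qed

text \<open>With \<open>t = y / x\<close> everything follows from \<open>exp z \<ge> 1 + z\<close>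
  and \<open>ln t \<le> t - 1\<close>; equality in the second only at \<open>t = 1\<close> gives
  strictness.\<close>

lemma powr_minus_above_tangent:
  fixes x y r :: real
  assumes "0 < x" "0 < y" "0 < r"
  shows "x powr (- r) - r * x powr (- r - 1) * (y - x) \<le> y powr (- r)"
    and "y \<noteq> x \<Longrightarrow> x powr (- r) - r * x powr (- r - 1) * (y - x) < y powr (- r)"
proof -
  define t where "t = y / x"
  have t: "0 < t" and y: "y = x * t" using assms by (auto simp: t_def)
  have 1: "1 - r * ln t \<le> t powr (- r)"
    using exp_ge_add_one_self[of "- r * ln t"] t by (simp add: powr_def)
  have 2: "1 - r * (t - 1) \<le> 1 - r * ln t"
    using ln_le_minus_one[OF t] assms by simp
  have 3: "1 - r * (t - 1) < 1 - r * ln t" if "t \<noteq> 1"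
    using ln_le_minus_one[OF t] ln_eq_minus_one[OF t] that assms by fastforce
  have x1: "x powr (- r - 1) * x = x powr (- r)"
    using powr_add[of x "- r - 1" 1] assms by simp
  have e1: "x powr (- r) - r * x powr (- r - 1) * (y - x) = x powr (- r) * (1 - r * (t - 1))"
    unfolding y x1[symmetric] by (simp add: algebra_simps)
  have e2: "y powr (- r) = x powr (- r) * t powr (- r)"
    unfolding y using assms t by (simp add: powr_mult)
  show "x powr (- r) - r * x powr (- r - 1) * (y - x) \<le> y powr (- r)"
    unfolding e1 e2 using 1 2 by (intro mult_left_mono) auto
  show "x powr (- r) - r * x powr (- r - 1) * (y - x) < y powr (- r)" if "y \<noteq> x"
  proof -
    have "t \<noteq> 1" using that y by auto
    then have "1 - r * (t - 1) < t powr (- r)" using 1 3 by linarith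
    then show ?thesis unfolding e1 e2 using assms by (intro mult_strict_left_mono) auto
  qed
qed

text \<open>Average the tangent inequalities at the convex combination with weights \<open>q\<close>
  and \<open>1 - q\<close>: the linear terms cancel.\<close>

lemma powr_minus_convex:
  fixes a b q r :: real
  assumes "0 < a" "0 < b" "0 < r" "0 < q" "q < 1"
  shows "(q * a + (1 - q) * b) powr (- r) \<le> q * a powr (- r) + (1 - q) * b powr (- r)"
    and "a \<noteq> b \<Longrightarrow> (q * a + (1 - q) * b) powr (- r) < q * a powr (- r) + (1 - q) * b powr (- r)"
proof -
  let ?c = "q * a + (1 - q) * b"
  have c: "0 < ?c" using assms by (simp add: add_pos_pos)
  let ?T = "\<lambda>y. ?c powr (- r) - r * ?c powr (- r - 1) * (y - ?c)"
  have eq: "?c powr (- r) = q * ?T a + (1 - q) * ?T b"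
  proof -
    have "q * ?T a + (1 - q) * ?T b
        = ?c powr (- r) - r * ?c powr (- r - 1) * (q * (a - ?c) + (1 - q) * (b - ?c))"
      by algebra
    also have "q * (a - ?c) + (1 - q) * (b - ?c) = 0" by algebra
    finally show ?thesis by simp
  qed
  show "?c powr (- r) \<le> q * a powr (- r) + (1 - q) * b powr (- r)"
    by (subst eq, intro add_mono mult_left_mono powr_minus_above_tangent(1) c assms)
      (use assms in auto)
  show "?c powr (- r) < q * a powr (- r) + (1 - q) * b powr (- r)" if "a \<noteq> b"
  proof -
    have "a - ?c = (1 - q) * (a - b)" by algebra
    then have "a \<noteq> ?c" using that assms by auto
    then have "q * ?T a < q * a powr (- r)"
      using assms c by (intro mult_strict_left_mono powr_minus_above_tangent(2)) auto
    moreover have "(1 - q) * ?T b \<le> (1 - q) * b powr (- r)"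
      using assms c by (intro mult_left_mono powr_minus_above_tangent(1)) auto
    ultimately show ?thesis by (subst eq) linarith
  qed
qed

text \<open>Reverse Minkowski inequality: after normalising both vectors to power mean 1 it becomes
  the convexity of \<open>x powr (- 1 / p)\<close>.\<close>

lemma power_mean_superadditive:
  fixes u v :: "'a \<Rightarrow> real"
  assumes p: "0 < p" and I: "finite I" "I \<noteq> {}"
    and u: "\<And>k. k \<in> I \<Longrightarrow> 0 < u k" and v: "\<And>k. k \<in> I \<Longrightarrow> 0 < v k"
  shows "power_mean p I u + power_mean p I v \<le> power_mean p I (\<lambda>k. u k + v k)"
    and "\<not> (\<exists>c. \<forall>k\<in>I. v k = c * u k) \<Longrightarrow>
         power_mean p I u + power_mean p I v < power_mean p I (\<lambda>k. u k + v k)"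
proof -
  let ?r = "1 / p"
  define S where "S = (\<lambda>w. \<Sum>k\<in>I. w k powr (- ?r))"
  have pm: "power_mean p I w = S w powr (- p)" if "\<And>k. k \<in> I \<Longrightarrow> 0 < w k" for w
    using power_mean_pos_eq[of I w p] that by (simp add: S_def)
  have Spos: "0 < S w" if "\<And>k. k \<in> I \<Longrightarrow> 0 < w k" for w
    unfolding S_def using I that by (intro sum_pos) (auto simp: less_le)
  define a b where "a = power_mean p I u" and "b = power_mean p I v"
  have a: "0 < a" and b: "0 < b"
    using pm[of u, OF u] pm[of v, OF v] Spos[of u, OF u] Spos[of v, OF v] by (simp_all add: a_def b_def)
  have S1: "S (\<lambda>k. w k / c) = 1" if w: "\<And>k. k \<in> I \<Longrightarrow> 0 < w k" and c: "c = power_mean p I w" for w c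
  proof -
    have "c > 0" using pm[of w, OF w] Spos[of w, OF w] c by auto
    have "S (\<lambda>k. w k / c) = S w / c powr (- ?r)"
      unfolding S_def sum_divide_distrib using w \<open>c > 0\<close>
      by (intro sum.cong) (auto simp: powr_divide less_imp_le)
    also have "c powr (- ?r) = S w" using pm[of w, OF w] Spos[of w, OF w] p by (simp add: c powr_powr)
    finally show ?thesis using Spos[of w, OF w] by simp
  qed
  \<comment> \<open>This weight makes \<open>(u + v) / (a + b)\<close> a convex combination of the
    normalised vectors \<open>u / a\<close> and \<open>v / b\<close>.\<close>
  define q where "q = a / (a + b)"
  have q: "0 < q" "q < 1" and q': "1 - q = b / (a + b)"
    using a b by (auto simp: q_def field_simps)
  let ?w = "\<lambda>k. (u k + v k) / (a + b)"
  have w_eq: "?w k = q * (u k / a) + (1 - q) * (v k / b)" for k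
    unfolding q' unfolding q_def using a b by (simp add: add_divide_distrib)
  have wpos: "0 < ?w k" if "k \<in> I" for k using u v a b that by (auto intro!: divide_pos_pos add_pos_pos)
  have term_le: "?w k powr (- ?r) \<le> q * (u k / a) powr (- ?r) + (1 - q) * (v k / b) powr (- ?r)"
    if "k \<in> I" for k
    unfolding w_eq using u v a b p q that by (intro powr_minus_convex(1)) auto
  have sum1: "(\<Sum>k\<in>I. q * (u k / a) powr (- ?r) + (1 - q) * (v k / b) powr (- ?r)) = 1"
    using S1[OF u a_def] S1[OF v b_def] unfolding S_def
    by (simp add: sum.distrib flip: sum_distrib_left)
  have pm_w: "power_mean p I (\<lambda>k. u k + v k) = (a + b) * power_mean p I ?w"
    proof -
    have "power_mean p I (\<lambda>k. (a + b) * ?w k) = (a + b) * power_mean p I ?w"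
      by (rule power_mean_scale) (use a b p wpos in auto)
    then show ?thesis using a b by simp
  qed
  have "S ?w \<le> (\<Sum>k\<in>I. q * (u k / a) powr (- ?r) + (1 - q) * (v k / b) powr (- ?r))"
    unfolding S_def by (rule sum_mono) (rule term_le)
  then have "S ?w \<le> 1" using sum1 by simp
  then have "1 \<le> power_mean p I ?w"
    using pm[of ?w, OF wpos] powr_mono2'[of "- p" "S ?w" 1] Spos[of ?w, OF wpos] p by simp
  then show "a + b \<le> power_mean p I (\<lambda>k. u k + v k)" unfolding pm_w using a b by simp
  assume np: "\<not> (\<exists>c. \<forall>k\<in>I. v k = c * u k)"
  \<comment> \<open>Non-proportionality is applied to the single candidate factor
    \<open>b / a\<close>: it yields an entry where the normalised vectors differ, and one strict
    term makes the sum strict.\<close>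
  then obtain k where k: "k \<in> I" "v k \<noteq> (b / a) * u k" by blast
  then have ne: "u k / a \<noteq> v k / b" using a b by (auto simp: field_simps)
  have "S ?w < (\<Sum>k\<in>I. q * (u k / a) powr (- ?r) + (1 - q) * (v k / b) powr (- ?r))"
    unfolding S_def
  proof (rule sum_strict_mono_strong[OF I(1) k(1)])
    show "?w k powr (- ?r) < q * (u k / a) powr (- ?r) + (1 - q) * (v k / b) powr (- ?r)"
      unfolding w_eq using u v a b p q k ne by (intro powr_minus_convex(2)) auto
  qed (rule term_le)
  then have "S ?w < 1" using sum1 by simp
  then have "1 < power_mean p I ?w"
    using pm[of ?w, OF wpos] powr_less_mono2_neg[of "- p" "S ?w" 1] Spos[of ?w, OF wpos] p by simp
  then show "a + b < power_mean p I (\<lambda>k. u k + v k)" unfolding pm_w using a b by simp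
qed

text \<open>If the limit has a zero entry, the mean is squeezed between 0 and the corresponding
  entry of the sequence, which is why 0 is the right default in \<open>power_mean\<close>. Otherwise
  only continuity of \<open>powr\<close> is involved.\<close>

lemma power_mean_tendsto:
  assumes p: "0 < p" and I: "finite I" "I \<noteq> {}"
    and pos: "\<And>n k. k \<in> I \<Longrightarrow> 0 < u n k" and lim: "\<And>k. k \<in> I \<Longrightarrow> (\<lambda>n. u n k) \<longlonglongrightarrow> l k"
  shows "(\<lambda>n::nat. power_mean p I (u n)) \<longlonglongrightarrow> power_mean p I l"
proof (cases "\<exists>k\<in>I. l k \<le> 0")
  case True
  then obtain k where k: "k \<in> I" "l k \<le> 0" by blast
  moreover have "0 \<le> l k" by (rule LIMSEQ_le_const[OF lim[OF k(1)]]) (use pos k in \<open>auto intro: less_imp_le\<close>)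
  ultimately have l0: "l k = 0" by simp
  have "(\<lambda>n. power_mean p I (u n)) \<longlonglongrightarrow> 0"
  proof (rule tendsto_sandwich[where f = "\<lambda>_. 0" and h = "\<lambda>n. u n k"])
    show "\<forall>\<^sub>F n in sequentially. power_mean p I (u n) \<le> u n k"
      by (intro always_eventually allI power_mean_le p I k(1) less_imp_le[OF pos])
    show "(\<lambda>n. u n k) \<longlonglongrightarrow> 0" using lim[OF k(1)] l0 by simp
  qed (auto simp: power_mean_nonneg)
  then show ?thesis using True by (simp add: power_mean_def)
next
  case False
  then have l: "\<And>k. k \<in> I \<Longrightarrow> 0 < l k" by force
  have "0 < (\<Sum>k\<in>I. l k powr (- (1 / p)))"
    using I l by (intro sum_pos) (auto simp: less_le)
  then have "(\<lambda>n. (\<Sum>k\<in>I. u n k powr (- (1 / p))) powr (- p)) \<longlonglongrightarrow> (\<Sum>k\<in>I. l k powr (- (1 / p))) powr (- p)"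
    using l by (intro tendsto_intros lim) force+
  then show ?thesis using pos l by (simp add: power_mean_pos_eq)
qed

text \<open>Factoring \<open>e powr (- (1 / p))\<close> out of the sum leaves
  \<open>e * (1 + e powr (1 / p) * ?S) powr (- p)\<close>. Hence a single vanishing entry switched
  on to \<open>e\<close> contributes \<open>e\<close> to first order, whatever the other positive
  entries are.\<close>

lemma power_mean_perturb_zero:
  assumes p: "0 < p" and I: "finite I" "k \<in> I" and pos: "\<And>l. l \<in> I - {k} \<Longrightarrow> 0 < u l"
  shows "((\<lambda>e. power_mean p I (u(k := e)) / e) \<longlongrightarrow> 1) (at_right 0)"
proof -
  let ?S = "\<Sum>l\<in>I - {k}. u l powr (- (1 / p))"
  have "((\<lambda>e. (1 + e powr (1 / p) * ?S) powr (- p)) \<longlongrightarrow> (1 + 0 powr (1 / p) * ?S) powr (- p)) (at_right 0)"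
    using p by (intro tendsto_intros) (auto simp: eventually_at_right intro!: exI[of _ 1])
  moreover have "\<forall>\<^sub>F e in at_right 0. (1 + e powr (1 / p) * ?S) powr (- p) = power_mean p I (u(k := e)) / e"
    unfolding eventually_at_right_field
  proof (intro exI[of _ 1] conjI allI impI)
    fix e :: real assume e: "0 < e" "e < 1"
    have "(\<Sum>l\<in>I. (u(k := e)) l powr (- (1 / p))) = e powr (- (1 / p)) + ?S"
      using I by (subst sum.remove[of I k]) (auto intro!: sum.cong)
    also have "\<dots> = e powr (- (1 / p)) * (1 + e powr (1 / p) * ?S)"
      using e by (simp add: distrib_left powr_minus)
    finally have "power_mean p I (u(k := e)) = (e powr (- (1 / p)) * (1 + e powr (1 / p) * ?S)) powr (- p)"
      using pos e by (subst power_mean_pos_eq) auto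
    also have "\<dots> = e * (1 + e powr (1 / p) * ?S) powr (- p)"
      using e p by (simp add: powr_mult powr_powr sum_nonneg)
    finally show "(1 + e powr (1 / p) * ?S) powr (- p) = power_mean p I (u(k := e)) / e"
      using e by simp
  qed simp
  ultimately show ?thesis using p by (simp add: tendsto_cong)
qed

section \<open>The variational problem\<close>

text \<open>A pair \<open>(i, j)\<close> also stands for the block \<open>{i..<j}\<close> of
  consecutive gaps between the particles \<open>i\<close> and \<open>j\<close>.\<close>

definition pairs :: "nat \<Rightarrow> (nat \<times> nat) set" where
  "pairs N = Sigma {1..N} (\<lambda>i. {i<..N})"

lemma mem_pairs: "(i, j) \<in> pairs N \<longleftrightarrow> 1 \<le> i \<and> i < j \<and> j \<le> N"
  by (auto simp: pairs_def)

lemma finite_pairs: "finite (pairs N)"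
  by (simp add: pairs_def)

lemma sum_off_diagonal:
  fixes h :: "nat \<Rightarrow> nat \<Rightarrow> real"
  shows "(\<Sum>i=1..N. \<Sum>j\<in>{1..N} - {i}. h i j) = (\<Sum>(i,j)\<in>pairs N. h i j + h j i)"
proof -
  have "(\<Sum>i=1..N. \<Sum>j\<in>{1..N} - {i}. h i j) = (\<Sum>(i,j)\<in>Sigma {1..N} (\<lambda>i. {1..N} - {i}). h i j)"
    by (rule sum.Sigma) auto
  also have "Sigma {1..N} (\<lambda>i. {1..N} - {i}) = pairs N \<union> prod.swap ` pairs N"
    by (auto simp: pairs_def image_iff)
  also have "(\<Sum>(i,j)\<in>pairs N \<union> prod.swap ` pairs N. h i j)
      = (\<Sum>(i,j)\<in>pairs N. h i j) + (\<Sum>(i,j)\<in>prod.swap ` pairs N. h i j)"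
    by (rule sum.union_disjoint) (auto simp: finite_pairs mem_pairs)
  also have "(\<Sum>(i,j)\<in>prod.swap ` pairs N. h i j) = (\<Sum>(i,j)\<in>pairs N. h j i)"
    by (subst sum.reindex) (auto simp: case_prod_unfold)
  finally show ?thesis by (simp add: sum.distrib case_prod_unfold)
qed

definition gap_mass :: "nat \<Rightarrow> (nat \<Rightarrow> real) \<Rightarrow> real" where
  "gap_mass N u = (\<Sum>k=1..<N. u k)"

definition interaction :: "nat \<Rightarrow> real \<Rightarrow> (nat \<Rightarrow> real) \<Rightarrow> real" where
  "interaction N p u = 2 * (\<Sum>(i,j)\<in>pairs N. power_mean p {i..<j} u)"

text \<open>Blocks longer than \<open>b\<close> contribute 0. A shorter one is at most its first
  entry \<open>u i\<close>, and each \<open>i\<close> starts at most \<open>b\<close> of them. With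
  \<open>b = N\<close> the run condition is vacuous and the ratio is bounded; with the longest
  positive run it bounds the ratio of a boundary maximiser.\<close>

lemma interaction_le_run_length:
  assumes p: "0 < p" and u: "\<And>k. k \<in> {1..<N} \<Longrightarrow> 0 \<le> u k"
    and run: "\<And>i j. (i, j) \<in> pairs N \<Longrightarrow> b < j - i \<Longrightarrow> \<exists>k\<in>{i..<j}. u k \<le> 0"
  shows "interaction N p u \<le> 2 * real b * gap_mass N u"
proof -
  have "(\<Sum>(i,j)\<in>pairs N. power_mean p {i..<j} u) = (\<Sum>i=1..N. \<Sum>j\<in>{i<..N}. power_mean p {i..<j} u)"
    unfolding pairs_def by (rule sum.Sigma[symmetric]) auto
  also have "\<dots> \<le> (\<Sum>i=1..N. if i < N then real b * u i else 0)"
  proof (rule sum_mono)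
    fix i assume i: "i \<in> {1..N}"
    have "(\<Sum>j\<in>{i<..N}. power_mean p {i..<j} u) \<le> real b * u i" if "i < N"
    proof -
      have "(\<Sum>j\<in>{i<..N}. power_mean p {i..<j} u) \<le> (\<Sum>j\<in>{i<..N}. if j \<le> i + b then u i else 0)"
      proof (rule sum_mono)
        fix j assume j: "j \<in> {i<..N}"
        show "power_mean p {i..<j} u \<le> (if j \<le> i + b then u i else 0)"
        proof (cases "j \<le> i + b")
          case True
          then show ?thesis using p u i j that by (auto intro!: power_mean_le)
        next
          case False
          then have "\<exists>k\<in>{i..<j}. u k \<le> 0" using run[of i j] i j by (auto simp: mem_pairs)
          then show ?thesis using False by (simp add: power_mean_def)
        qed
      qed
      also have "\<dots> = (\<Sum>j\<in>{j\<in>{i<..N}. j \<le> i + b}. u i)"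
        by (subst sum.inter_filter) auto
      also have "\<dots> = real (card {j\<in>{i<..N}. j \<le> i + b}) * u i" by simp
      also have "\<dots> \<le> real b * u i"
      proof (rule mult_right_mono)
        have "card {j\<in>{i<..N}. j \<le> i + b} \<le> card {i<..i+b}" by (rule card_mono) auto
        then show "real (card {j\<in>{i<..N}. j \<le> i + b}) \<le> real b" by simp
      qed (use u i that in auto)
      finally show ?thesis .
    qed
    then show "(\<Sum>j\<in>{i<..N}. power_mean p {i..<j} u) \<le> (if i < N then real b * u i else 0)"
      using i by (auto simp: not_less)
  qed
  also have "\<dots> = (\<Sum>i\<in>{1..<N}. real b * u i)"
    by (rule sum.mono_neutral_cong_right) auto
  also have "\<dots> = real b * gap_mass N u" by (simp add: gap_mass_def sum_distrib_left)
  finally show ?thesis unfolding interaction_def by simp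
qed

lemma interaction_mono:
  assumes "0 < p" "\<And>k. k \<in> {1..<N} \<Longrightarrow> u k \<le> v k"
  shows "interaction N p u \<le> interaction N p v"
  unfolding interaction_def
  using assms by (intro mult_left_mono sum_mono) (auto simp: mem_pairs intro!: power_mean_mono)

lemma interaction_scale:
  assumes "0 < p" "0 < c" "\<And>k. k \<in> {1..<N} \<Longrightarrow> 0 < u k"
  shows "interaction N p (\<lambda>k. c * u k) = c * interaction N p u"
proof -
  have "(\<Sum>(i,j)\<in>pairs N. power_mean p {i..<j} (\<lambda>k. c * u k)) = (\<Sum>(i,j)\<in>pairs N. c * power_mean p {i..<j} u)"
    using assms by (intro sum.cong) (auto simp: mem_pairs intro!: power_mean_scale)
  then show ?thesis by (simp add: interaction_def case_prod_unfold flip: sum_distrib_left)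
qed

lemma interaction_tendsto:
  assumes "0 < p" "\<And>n k. k \<in> {1..<N} \<Longrightarrow> 0 < u n k" "\<And>k. k \<in> {1..<N} \<Longrightarrow> (\<lambda>n. u n k) \<longlonglongrightarrow> l k"
  shows "(\<lambda>n::nat. interaction N p (u n)) \<longlonglongrightarrow> interaction N p l"
  unfolding interaction_def case_prod_unfold
  using assms by (intro tendsto_intros power_mean_tendsto) (auto simp: pairs_def)

text \<open>The block of the pair \<open>(1, N)\<close> contains every gap, so non-proportionality
  is already visible there; weak superadditivity suffices for the other blocks.\<close>

lemma interaction_strictly_superadditive:
  assumes p: "0 < p" and N: "2 \<le> N"
    and u: "\<And>k. k \<in> {1..<N} \<Longrightarrow> 0 < u k" and v: "\<And>k. k \<in> {1..<N} \<Longrightarrow> 0 < v k"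
    and np: "\<not> (\<exists>c. \<forall>k\<in>{1..<N}. v k = c * u k)"
  shows "interaction N p u + interaction N p v < interaction N p (\<lambda>k. u k + v k)"
proof -
  have "(\<Sum>(i,j)\<in>pairs N. power_mean p {i..<j} u + power_mean p {i..<j} v)
      < (\<Sum>(i,j)\<in>pairs N. power_mean p {i..<j} (\<lambda>k. u k + v k))"
  proof (rule sum_strict_mono_strong[of _ "(1, N)"])
    show "(case (1, N) of (i, j) \<Rightarrow> power_mean p {i..<j} u + power_mean p {i..<j} v)
        < (case (1, N) of (i, j) \<Rightarrow> power_mean p {i..<j} (\<lambda>k. u k + v k))"
      unfolding prod.case by (rule power_mean_superadditive(2)) (use assms in auto)
  next
    fix x assume "x \<in> pairs N"
    then show "(case x of (i, j) \<Rightarrow> power_mean p {i..<j} u + power_mean p {i..<j} v)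
        \<le> (case x of (i, j) \<Rightarrow> power_mean p {i..<j} (\<lambda>k. u k + v k))"
      using p u v by (cases x) (auto simp: mem_pairs intro!: power_mean_superadditive(1))
  qed (use N in \<open>auto simp: finite_pairs mem_pairs\<close>)
  then show ?thesis by (simp add: interaction_def case_prod_unfold sum.distrib)
qed

section \<open>Configurations, their gaps and the substitution by gap powers\<close>

text \<open>The zero-sum condition is left out because partial derivatives move one coordinate and
  so leave the hyperplane of \<open>inRN\<close>.\<close>

definition ordered :: "nat \<Rightarrow> (nat \<Rightarrow> real) \<Rightarrow> bool" where
  "ordered N X \<longleftrightarrow> (\<forall>i\<in>{1..<N}. X i < X (Suc i))"

lemma inRN_ordered: "inRN N X \<Longrightarrow> ordered N X"
  by (simp add: inRN_def ordered_def)

lemma gaps_telescope: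
  fixes X :: "nat \<Rightarrow> real"
  shows "i \<le> j \<Longrightarrow> (\<Sum>k=i..<j. X (Suc k) - X k) = X j - X i"
  by (rule sum_Suc_diff')

lemma ordered_less:
  assumes "ordered N X" "(i, j) \<in> pairs N"
  shows "X i < X j"
proof -
  have "0 < (\<Sum>k=i..<j. X (Suc k) - X k)"
    using assms by (intro sum_pos) (auto simp: ordered_def mem_pairs)
  then show ?thesis using gaps_telescope[of i j X] assms by (simp add: mem_pairs)
qed

text \<open>The substitution \<open>u k = gap k powr (1 - m)\<close> makes the numerator and the denominator of the
  ratio a concave 1-homogeneous and a linear function, respectively.\<close>

definition gap_powers :: "real \<Rightarrow> (nat \<Rightarrow> real) \<Rightarrow> nat \<Rightarrow> real" where
  "gap_powers m X k = (X (Suc k) - X k) powr (1 - m)"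

lemma gap_powers_pos: "ordered N X \<Longrightarrow> k \<in> {1..<N} \<Longrightarrow> 0 < gap_powers m X k"
  by (force simp: ordered_def gap_powers_def)

lemma gap_from_power:
  assumes "1 < m" "ordered N X" "k \<in> {1..<N}"
  shows "gap_powers m X k powr (- (1 / (m - 1))) = X (Suc k) - X k"
proof -
  have "(1 - m) * (- (1 / (m - 1))) = 1" using assms(1) by (simp add: field_simps)
  moreover have "0 < X (Suc k) - X k" using assms by (auto simp: ordered_def)
  ultimately show ?thesis by (simp add: gap_powers_def powr_powr)
qed

text \<open>For \<open>p = m - 1\<close> the summands inside the mean are the gaps themselves, and
  they telescope.\<close>

lemma power_mean_gap_powers:
  assumes "1 < m" "ordered N X" "(i, j) \<in> pairs N"
  shows "power_mean (m - 1) {i..<j} (gap_powers m X) = (X j - X i) powr (1 - m)"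
proof -
  have "(\<Sum>k=i..<j. gap_powers m X k powr (- (1 / (m - 1)))) = (\<Sum>k=i..<j. X (Suc k) - X k)"
    using assms by (intro sum.cong gap_from_power) (auto simp: mem_pairs)
  also have "\<dots> = X j - X i" using assms by (intro gaps_telescope) (simp add: mem_pairs)
  finally show ?thesis
    using assms gap_powers_pos[OF assms(2)] by (subst power_mean_pos_eq) (auto simp: mem_pairs)
qed

lemma double_sum_eq_interaction:
  assumes "1 < m" "ordered N X"
  shows "(\<Sum>i=1..N. \<Sum>j\<in>{1..N} - {i}. \<bar>X j - X i\<bar> powr (1 - m)) = interaction N (m - 1) (gap_powers m X)"
proof -
  have "(\<Sum>(i,j)\<in>pairs N. \<bar>X j - X i\<bar> powr (1 - m) + \<bar>X i - X j\<bar> powr (1 - m))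
      = (\<Sum>(i,j)\<in>pairs N. 2 * power_mean (m - 1) {i..<j} (gap_powers m X))"
  proof (rule sum.cong[OF refl], clarify)
    fix i j assume ij: "(i, j) \<in> pairs N"
    have "\<bar>X j - X i\<bar> = X j - X i" "\<bar>X i - X j\<bar> = X j - X i"
      using ordered_less[OF assms(2) ij] by auto
    then show "\<bar>X j - X i\<bar> powr (1 - m) + \<bar>X i - X j\<bar> powr (1 - m)
        = 2 * power_mean (m - 1) {i..<j} (gap_powers m X)"
      using power_mean_gap_powers[OF assms ij] by simp
  qed
  then show ?thesis
    by (simp only: sum_off_diagonal interaction_def case_prod_unfold sum_distrib_left)
qed

lemma ratioN_eq:
  assumes "1 < m" "ordered N X"
  shows "ratioN N m X = interaction N (m - 1) (gap_powers m X) / gap_mass N (gap_powers m X)"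
  using double_sum_eq_interaction[OF assms] by (simp add: ratioN_def gap_mass_def gap_powers_def)

lemma FNm_eq:
  assumes "1 < m" "ordered N X"
  shows "FNm N m chi X
      = (gap_mass N (gap_powers m X) - chi * interaction N (m - 1) (gap_powers m X)) / (m - 1)"
  using double_sum_eq_interaction[OF assms]
  by (simp add: FNm_def gap_mass_def gap_powers_def abs_minus_commute diff_divide_distrib)

text \<open>Partial sums of \<open>d\<close>, shifted by their average. The gaps are thus free
  coordinates, which lets the supremum over configurations be read as one over all positive
  vectors.\<close>

lemma inRN_of_gaps:
  assumes N: "2 \<le> N" and d: "\<And>k. k \<in> {1..<N} \<Longrightarrow> 0 < d k"
  shows "\<exists>X. inRN N X \<and> (\<forall>k\<in>{1..<N}. X (Suc k) - X k = d k)"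
proof -
  define S where "S = (\<lambda>i::nat. \<Sum>k=1..<i. d k)"
  define X where "X = (\<lambda>i. if i \<in> {1..N} then S i - (\<Sum>i=1..N. S i) / real N else 0)"
  have gap: "X (Suc k) - X k = d k" if "k \<in> {1..<N}" for k
    using that by (auto simp: X_def S_def)
  have "(\<Sum>i=1..N. X i) = (\<Sum>i=1..N. S i - (\<Sum>i=1..N. S i) / real N)"
    by (rule sum.cong) (auto simp: X_def)
  also have "\<dots> = 0" using N by (simp add: sum_subtractf)
  finally have "(\<Sum>i=1..N. X i) = 0" .
  moreover have "X i < X (Suc i)" if "i \<in> {1..<N}" for i using gap[OF that] d[OF that] by linarith
  ultimately have "inRN N X" by (auto simp: inRN_def X_def)
  then show ?thesis using gap by blast
qed

text \<open>Equal gaps make \<open>Y j - c * X j\<close> independent of \<open>j\<close>, and the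
  zero-sum condition makes that constant vanish.\<close>

lemma inRN_proportional_gaps:
  assumes "inRN N X" "inRN N Y" and g: "\<And>k. k \<in> {1..<N} \<Longrightarrow> Y (Suc k) - Y k = c * (X (Suc k) - X k)"
  shows "Y i = c * X i"
proof (cases "i \<in> {1..N}")
  case False
  then show ?thesis using assms by (simp add: inRN_def)
next
  case i: True
  have const: "Y j - c * X j = Y 1 - c * X 1" if "j \<in> {1..N}" for j
  proof -
    have "Y j - Y 1 = (\<Sum>k=1..<j. Y (Suc k) - Y k)" using gaps_telescope[of 1 j Y] that by simp
    also have "\<dots> = (\<Sum>k=1..<j. c * (X (Suc k) - X k))" using that by (intro sum.cong g) auto
    also have "\<dots> = c * (X j - X 1)" using gaps_telescope[of 1 j X] that by (simp flip: sum_distrib_left)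
    finally show ?thesis by (simp add: algebra_simps)
  qed
  have "(\<Sum>j=1..N. Y j - c * X j) = 0"
    using assms by (simp add: inRN_def sum_subtractf flip: sum_distrib_left)
  moreover have "(\<Sum>j=1..N. Y j - c * X j) = (\<Sum>j=1..N. Y 1 - c * X 1)" by (rule sum.cong[OF refl const])
  ultimately have "Y 1 - c * X 1 = 0" using i by auto
  then show ?thesis using const[OF i] by simp
qed

text \<open>By the zero-sum condition \<open>N * X i\<close> is the sum of the differences
  \<open>X i - X j\<close>, each at most the diameter \<open>X N - X 1\<close> in absolute
  value.\<close>

lemma inRN_abs_le:
  assumes X: "inRN N X" and i: "i \<in> {1..N}"
  shows "\<bar>X i\<bar> \<le> (\<Sum>k=1..<N. X (Suc k) - X k)"
proof -
  have mono: "X a \<le> X b" if "a \<le> b" "1 \<le> a" "b \<le> N" for a b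
    using ordered_less[OF inRN_ordered[OF X], of a b] that by (cases "a = b") (auto simp: mem_pairs)
  have G: "(\<Sum>k=1..<N. X (Suc k) - X k) = X N - X 1" using i by (intro gaps_telescope) auto
  have "real N * \<bar>X i\<bar> = \<bar>\<Sum>j=1..N. X i - X j\<bar>"
    using X by (simp add: inRN_def sum_subtractf abs_mult)
  also have "\<dots> \<le> (\<Sum>j=1..N. \<bar>X i - X j\<bar>)" by (rule sum_abs)
  also have "\<dots> \<le> (\<Sum>j=1..N. X N - X 1)"
  proof (rule sum_mono)
    fix j assume "j \<in> {1..N}"
    then show "\<bar>X i - X j\<bar> \<le> X N - X 1"
      using mono[of i N] mono[of 1 i] mono[of j N] mono[of 1 j] i by auto
  qed
  also have "\<dots> = real N * (X N - X 1)" by simp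
  finally show ?thesis unfolding G using i by (simp add: mult_le_cancel_left)
qed

lemma enorm_le_gaps:
  assumes X: "inRN N X"
  shows "enorm N X \<le> sqrt (real N) * (\<Sum>k=1..<N. X (Suc k) - X k)"
proof -
  let ?G = "\<Sum>k=1..<N. X (Suc k) - X k"
  have G: "0 \<le> ?G" using X by (intro sum_nonneg) (auto simp: inRN_def less_imp_le)
  have "(\<Sum>i=1..N. (X i)\<^sup>2) \<le> (\<Sum>i=1..N. ?G\<^sup>2)"
    using inRN_abs_le[OF X] G by (intro sum_mono) (metis abs_le_square_iff abs_of_nonneg)
  then have "enorm N X \<le> sqrt (real N * ?G\<^sup>2)" unfolding enorm_def by simp
  then show ?thesis using G by (simp add: real_sqrt_mult)
qed

section \<open>The maximal ratio and the zeros of the energy\<close>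

locale critical_gradient_flow =
  fixes N :: nat and m :: real
  assumes m: "1 < m" and N: "2 \<le> N"
begin

definition max_ratio :: real where
  "max_ratio = (SUP X\<in>{X. inRN N X}. ratioN N m X)"

abbreviation chi :: real where "chi \<equiv> CN N m"
abbreviation F :: "(nat \<Rightarrow> real) \<Rightarrow> real" where "F \<equiv> FNm N m chi"
abbreviation mass :: "(nat \<Rightarrow> real) \<Rightarrow> real" where "mass \<equiv> gap_mass N"
abbreviation inter :: "(nat \<Rightarrow> real) \<Rightarrow> real" where "inter \<equiv> interaction N (m - 1)"

lemma chi_eq: "chi = 1 / max_ratio"
  by (simp add: CN_def max_ratio_def)

lemma mass_pos: "(\<And>k. k \<in> {1..<N} \<Longrightarrow> 0 < u k) \<Longrightarrow> 0 < mass u"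
  unfolding gap_mass_def using N by (intro sum_pos) auto

text \<open>The content is the boundedness of the ratio, without which the supremum in
  \<open>max_ratio\<close> would carry no information.\<close>

lemma ratioN_le:
  assumes "inRN N X"
  shows "ratioN N m X \<le> max_ratio"
proof -
  have "ratioN N m X \<le> 2 * real N" if "inRN N X" for X
  proof -
    note o = inRN_ordered[OF that]
    have "inter (gap_powers m X) \<le> 2 * real N * mass (gap_powers m X)"
      by (rule interaction_le_run_length)
        (use m gap_powers_pos[OF o] in \<open>auto simp: mem_pairs less_imp_le\<close>)
    then show ?thesis
      using mass_pos[OF gap_powers_pos[OF o]] by (simp add: ratioN_eq[OF m o] field_simps)
  qed
  then have "bdd_above (ratioN N m ` {X. inRN N X})" by (auto intro!: bdd_aboveI)
  then show ?thesis unfolding max_ratio_def using assms by (intro cSUP_upper) auto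
qed

text \<open>Take the configuration whose gaps are \<open>u k powr (- (1 / (m - 1)))\<close>; its gap
  powers are \<open>u\<close>, so the bound on its ratio is the claim.\<close>

lemma inter_le_of_pos:
  assumes u: "\<And>k. k \<in> {1..<N} \<Longrightarrow> 0 < u k"
  shows "inter u \<le> max_ratio * mass u"
proof -
  obtain X where X: "inRN N X" and gap: "\<And>k. k \<in> {1..<N} \<Longrightarrow> X (Suc k) - X k = u k powr (- (1 / (m - 1)))"
    using inRN_of_gaps[OF N, of "\<lambda>k. u k powr (- (1 / (m - 1)))"] u by force
  note o = inRN_ordered[OF X]
  have e: "(- (1 / (m - 1))) * (1 - m) = 1" using m by (simp add: field_simps)
  have gp: "gap_powers m X k = u k" if "k \<in> {1..<N}" for k
    unfolding gap_powers_def gap[OF that] powr_powr e using u[OF that] by simp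
  have "inter (gap_powers m X) = inter u"
    by (intro antisym interaction_mono) (use gp m in auto)
  moreover have "mass (gap_powers m X) = mass u" unfolding gap_mass_def using gp by simp
  ultimately have "inter u / mass u \<le> max_ratio" using ratioN_le[OF X] by (simp add: ratioN_eq[OF m o])
  then show ?thesis using mass_pos[OF u] by (simp add: field_simps)
qed

text \<open>Raise all entries by \<open>1 / (n + 1)\<close> to reach the positive case. As
  \<open>interaction\<close> is monotone, the limit is needed only on the linear right-hand
  side.\<close>

lemma inter_le:
  assumes u: "\<And>k. k \<in> {1..<N} \<Longrightarrow> 0 \<le> u k"
  shows "inter u \<le> max_ratio * mass u"
proof -
  let ?v = "\<lambda>n k. u k + 1 / real (Suc n)"
  have "(\<lambda>n. max_ratio * mass (?v n)) \<longlonglongrightarrow> max_ratio * mass (\<lambda>k. u k + 0)"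
    unfolding gap_mass_def by (intro tendsto_intros LIMSEQ_Suc[OF lim_1_over_n])
  moreover have "inter u \<le> max_ratio * mass (?v n)" for n
  proof -
    have "inter u \<le> inter (?v n)" by (rule interaction_mono) (use m in auto)
    also have "\<dots> \<le> max_ratio * mass (?v n)"
      by (rule inter_le_of_pos) (use u in \<open>auto intro!: add_nonneg_pos\<close>)
    finally show ?thesis .
  qed
  ultimately show ?thesis by (intro LIMSEQ_le_const[where x = "max_ratio * mass u"]) auto
qed

lemma max_ratio_pos: "0 < max_ratio"
proof -
  have "(1, N) \<in> pairs N" using N by (simp add: mem_pairs)
  then have "pairs N \<noteq> {}" by blast
  then have "0 < inter (\<lambda>_. 1)"
    unfolding interaction_def
    by (intro mult_pos_pos sum_pos finite_pairs) (auto simp: mem_pairs power_mean_pos_eq)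
  also have "\<dots> \<le> max_ratio * mass (\<lambda>_. 1)" by (rule inter_le) auto
  finally show ?thesis using mass_pos[of "\<lambda>_. 1"] by (simp add: zero_less_mult_iff)
qed

lemma chi_pos: "0 < chi"
  using max_ratio_pos by (simp add: chi_eq)

lemma F_nonneg:
  assumes "ordered N X"
  shows "0 \<le> F X"
proof -
  have "inter (gap_powers m X) \<le> max_ratio * mass (gap_powers m X)"
    by (rule inter_le_of_pos) (rule gap_powers_pos[OF assms])
  then show ?thesis
    unfolding FNm_eq[OF m assms] chi_eq using m max_ratio_pos by (simp add: field_simps)
qed

text \<open>Two minimisers with non-proportional gaps would, by strict superadditivity, add up to a
  configuration exceeding the maximal ratio.\<close>

lemma zeros_of_F_proportional:
  assumes X: "inRN N X" and Y: "inRN N Y" and "F X = 0" "F Y = 0"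
  shows "\<exists>c>0. \<forall>i. Y i = c * X i"
proof -
  let ?u = "gap_powers m X" and ?v = "gap_powers m Y"
  note oX = inRN_ordered[OF X] and oY = inRN_ordered[OF Y]
  note u = gap_powers_pos[OF oX, of _ m] and v = gap_powers_pos[OF oY, of _ m]
  have opt: "inter (gap_powers m Z) = max_ratio * mass (gap_powers m Z)" if "F Z = 0" "ordered N Z" for Z
    using that max_ratio_pos m by (simp add: FNm_eq[OF m] chi_eq field_simps)
  have "\<exists>c. \<forall>k\<in>{1..<N}. ?v k = c * ?u k"
  proof (rule ccontr)
    assume np: "\<not> ?thesis"
    have "inter ?u + inter ?v < inter (\<lambda>k. ?u k + ?v k)"
      by (rule interaction_strictly_superadditive[OF _ N u v np]) (use m in simp)
    also have "\<dots> \<le> max_ratio * mass (\<lambda>k. ?u k + ?v k)"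
      using u v by (intro inter_le_of_pos add_pos_pos)
    also have "\<dots> = inter ?u + inter ?v"
      using opt[OF assms(3) oX] opt[OF assms(4) oY] by (simp add: gap_mass_def sum.distrib distrib_left)
    finally show False by simp
  qed
  then obtain c where c: "\<And>k. k \<in> {1..<N} \<Longrightarrow> ?v k = c * ?u k" by blast
  have "0 < c" using c[of 1] u[of 1] v[of 1] N by (auto simp: zero_less_mult_iff)
  have "Y (Suc k) - Y k = c powr (- (1 / (m - 1))) * (X (Suc k) - X k)" if k: "k \<in> {1..<N}" for k
    using gap_from_power[OF m oX k] gap_from_power[OF m oY k] c[OF k] \<open>0 < c\<close> u[OF k]
    by (simp add: powr_mult)
  from inRN_proportional_gaps[OF X Y this] show ?thesis
    using \<open>0 < c\<close> by (intro exI[of _ "c powr (- (1 / (m - 1)))"]) simp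
qed

section \<open>Interior maximisers and the lower bound on gaps\<close>

text \<open>Raise the zero entry \<open>k\<close> to a small \<open>e\<close>. The mass grows by
  \<open>e\<close>, each block in \<open>J\<close> grows from 0 to \<open>e\<close> to first order,
  and no other block decreases. Since \<open>u\<close> attains the maximal ratio, the gain
  \<open>2 * card J\<close> cannot exceed \<open>max_ratio\<close>.\<close>

lemma perturbed_zero_gap_bound:
  assumes u: "\<And>l. l \<in> {1..<N} \<Longrightarrow> 0 \<le> u l" and max: "max_ratio * mass u \<le> inter u"
    and k: "k \<in> {1..<N}" "u k = 0" and J: "J \<subseteq> pairs N"
    and Jk: "\<And>i j. (i, j) \<in> J \<Longrightarrow> k \<in> {i..<j}"
    and Jpos: "\<And>i j l. (i, j) \<in> J \<Longrightarrow> l \<in> {i..<j} - {k} \<Longrightarrow> 0 < u l"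
  shows "2 * real (card J) \<le> max_ratio"
proof -
  have finJ: "finite J" using J finite_pairs finite_subset by blast
  let ?T = "\<lambda>e. 2 * (\<Sum>(i,j)\<in>J. power_mean (m - 1) {i..<j} (u(k := e)) / e)"
  have lim: "(?T \<longlongrightarrow> 2 * (\<Sum>(i,j)\<in>J. 1)) (at_right 0)"
    unfolding case_prod_unfold
    by (intro tendsto_intros power_mean_perturb_zero)
      (use m Jk Jpos in \<open>auto simp: mem_pairs\<close>)
  have "?T e \<le> max_ratio" if e: "0 < e" for e
  proof -
    let ?v = "u(k := e)"
    have zero: "power_mean (m - 1) {i..<j} u = 0" if "(i, j) \<in> J" for i j
      using Jk[OF that] k by (force simp: power_mean_def)
    have "inter u = 2 * (\<Sum>(i,j)\<in>pairs N - J. power_mean (m - 1) {i..<j} u)"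
      unfolding interaction_def
      by (subst sum.subset_diff[OF J finite_pairs]) (use zero in \<open>auto intro!: sum.neutral\<close>)
    also have "\<dots> \<le> 2 * (\<Sum>(i,j)\<in>pairs N - J. power_mean (m - 1) {i..<j} ?v)"
      using m e k by (intro mult_left_mono sum_mono) (auto intro!: power_mean_mono)
    also have "\<dots> + 2 * (\<Sum>(i,j)\<in>J. power_mean (m - 1) {i..<j} ?v) = inter ?v"
      unfolding interaction_def by (subst sum.subset_diff[OF J finite_pairs, of "\<lambda>(i,j). power_mean (m - 1) {i..<j} ?v"]) simp
    also have "inter ?v \<le> max_ratio * mass ?v" by (rule inter_le) (use u e in auto)
    also have "mass ?v = mass u + e"
    proof -
      have "mass ?v = e + (\<Sum>l\<in>{1..<N} - {k}. u l)"
        unfolding gap_mass_def using k by (subst sum.remove[of _ k]) (auto intro!: sum.cong)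
      also have "(\<Sum>l\<in>{1..<N} - {k}. u l) = mass u"
        unfolding gap_mass_def using k by (subst sum.remove[of "{1..<N}" k]) auto
      finally show ?thesis by (simp only: add.commute)
    qed
    finally have "2 * (\<Sum>(i,j)\<in>J. power_mean (m - 1) {i..<j} ?v) \<le> max_ratio * e"
      unfolding distrib_left using max by linarith
    then show ?thesis
      using e by (simp add: case_prod_unfold field_simps flip: sum_divide_distrib)
  qed
  then have "\<forall>\<^sub>F e in at_right 0. ?T e \<le> max_ratio"
    by (auto simp: eventually_at_right_field intro!: exI[of _ 1])
  with lim have "2 * (\<Sum>(i,j)\<in>J. 1) \<le> max_ratio"
    by (intro tendsto_upperbound) auto
  then show ?thesis by (simp add: case_prod_unfold)
qed

text \<open>A maximiser on the boundary of the simplex has ratio at most \<open>2 b\<close>, where \<open>b\<close> is the length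
  of a longest run of positive entries, whereas switching on a zero entry next to such a run
  increases numerator and denominator at the relative rate \<open>2 (b + 1)\<close>.\<close>

lemma maximiser_pos:
  assumes u: "\<And>l. l \<in> {1..<N} \<Longrightarrow> 0 \<le> u l" and pos: "0 < mass u"
    and max: "max_ratio * mass u \<le> inter u" and k: "k \<in> {1..<N}"
  shows "0 < u k"
proof (rule ccontr)
  assume "\<not> 0 < u k"
  then have uk: "u k = 0" using u[OF k] by simp
  define R where "R = {(i, j) \<in> pairs N. \<forall>l\<in>{i..<j}. 0 < u l}"
  have finR: "finite R" unfolding R_def using finite_pairs by (rule rev_finite_subset) auto
  obtain l where l: "l \<in> {1..<N}" "0 < u l"
  proof -
    have "\<not> (\<forall>l\<in>{1..<N}. u l \<le> 0)"
      using pos sum_nonpos[of "{1..<N}" u] unfolding gap_mass_def by (metis not_le)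
    then show thesis using that by force
  qed
  then have neR: "R \<noteq> {}" proof -
    have "(l, Suc l) \<in> R" using l by (auto simp: R_def mem_pairs less_Suc_eq)
    then show ?thesis by blast
  qed
  define b where "b = Max ((\<lambda>(i, j). j - i) ` R)"
  have "b \<in> (\<lambda>(i, j). j - i) ` R" unfolding b_def using finR neR by (intro Max_in) auto
  then obtain i j where ij: "(i, j) \<in> R" and b: "b = j - i" by auto
  have bmax: "j' - i' \<le> b" if "(i', j') \<in> R" for i' j'
    unfolding b_def using finR that by (intro Max_ge) force+
  have ijN: "1 \<le> i" "i < j" "j \<le> N" and ijpos: "\<And>l. l \<in> {i..<j} \<Longrightarrow> 0 < u l"
    using ij by (auto simp: R_def mem_pairs)
  have "inter u \<le> 2 * real b * mass u"
  proof (rule interaction_le_run_length)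
    fix i' j' assume "(i', j') \<in> pairs N" "b < j' - i'"
    then have "(i', j') \<notin> R" using bmax[of i' j'] by linarith
    then show "\<exists>k\<in>{i'..<j'}. u k \<le> 0" using \<open>(i', j') \<in> pairs N\<close> by (auto simp: R_def not_less)
  qed (use m u in auto)
  then have "max_ratio * mass u \<le> 2 * real b * mass u" using max by simp
  then have le_b: "max_ratio \<le> 2 * real b" using pos by simp
  show False
  \<comment> \<open>The run fills \<open>{i..<j}\<close>. Its right neighbour \<open>j\<close> is a
    gap index only if \<open>j < N\<close>; otherwise the left neighbour is used, and it exists
    because a run of all gaps would contain the zero entry \<open>k\<close>.\<close>
  proof (cases "j < N")
    case True
    have uj: "u j = 0"
    proof (rule ccontr)
      assume "u j \<noteq> 0"
      then have "0 < u j" using u[of j] ijN True by auto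
      then have "(i, Suc j) \<in> R" using True ijN ijpos by (auto simp: R_def mem_pairs less_Suc_eq)
      then show False using bmax[of i "Suc j"] b ijN by auto
    qed
    \<comment> \<open>The blocks ending with the zero entry \<open>j\<close> and starting anywhere
      from \<open>i\<close> to \<open>j\<close>. The singleton block at \<open>a = j\<close> makes
      them \<open>b + 1\<close> in number, one more than the run length.\<close>
    have "2 * real (card ((\<lambda>a. (a, Suc j)) ` {i..j})) \<le> max_ratio"
      by (rule perturbed_zero_gap_bound[OF u max _ uj])
        (use True ijN in \<open>auto simp: mem_pairs intro!: ijpos\<close>)
    moreover have "card ((\<lambda>a. (a, Suc j)) ` {i..j}) = b + 1"
      using ijN b by (subst card_image) (auto simp: inj_on_def)
    ultimately show False using le_b by simp
  next
    case False
    then have j: "j = N" using ijN by simp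
    have "i \<noteq> 1"
    proof
      assume "i = 1"
      then show False using ijpos[of k] k uk j by auto
    qed
    then obtain h where h: "i = Suc h" "1 \<le> h" using ijN by (cases i) auto
    have uh: "u h = 0"
    proof (rule ccontr)
      assume "u h \<noteq> 0"
      then have "0 < u h" using u[of h] ijN h by auto
      have "0 < u l" if "l \<in> {h..<j}" for l
        using that \<open>0 < u h\<close> ijpos[of l] h by (cases "l = h") auto
      then have "(h, j) \<in> R" using ijN h by (auto simp: R_def mem_pairs)
      then show False using bmax[of h j] b ijN h by auto
    qed
    \<comment> \<open>The mirror image: blocks starting with the zero entry \<open>h\<close>, where
      \<open>a = i\<close> gives the singleton.\<close>
    have "2 * real (card ((\<lambda>a. (h, a)) ` {i..j})) \<le> max_ratio"
      by (rule perturbed_zero_gap_bound[OF u max _ uh])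
        (use ijN h in \<open>auto simp: mem_pairs intro!: ijpos\<close>)
    moreover have "card ((\<lambda>a. (h, a)) ` {i..j}) = b + 1"
      using ijN b by (subst card_image) (auto simp: inj_on_def)
    ultimately show False using le_b by simp
  qed
qed

text \<open>If a gap degenerates while \<open>F\<close> stays bounded, then the normalised gap powers approach a
  maximiser of the ratio; as its entries are all positive, all gaps degenerate together.\<close>

lemma gaps_bounded_below:
  assumes r: "0 < r"
  shows "\<exists>d>0. \<forall>X. inRN N X \<and> F X \<le> K \<and> r \<le> enorm N X \<longrightarrow> (\<forall>k\<in>{1..<N}. d \<le> X (Suc k) - X k)"
proof (rule ccontr)
  assume neg: "\<not> ?thesis"
  let ?P = "\<lambda>n X. inRN N X \<and> F X \<le> K \<and> r \<le> enorm N X \<and>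
    (\<exists>k\<in>{1..<N}. X (Suc k) - X k < 1 / real (Suc n))"
  have "\<exists>X. ?P n X" for n
  proof -
    have "(0::real) < 1 / real (Suc n)" by simp
    then show ?thesis using neg by (metis not_le)
  qed
  then obtain X where "\<And>n. ?P n (X n)" by metis
  then have X: "\<And>n. inRN N (X n)" and FK: "\<And>n. F (X n) \<le> K" and Xr: "\<And>n. r \<le> enorm N (X n)"
    and small: "\<And>n. \<exists>k\<in>{1..<N}. X n (Suc k) - X n k < 1 / real (Suc n)" by blast+
  note o = inRN_ordered[OF X]
  let ?q = "1 / (m - 1)"
  define U where "U = (\<lambda>n. gap_powers m (X n))"
  define A where "A = (\<lambda>n. mass (U n))"
  have U: "0 < U n k" if "k \<in> {1..<N}" for n k
    unfolding U_def using gap_powers_pos[OF o that] .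
  have A: "0 < A n" for n unfolding A_def by (rule mass_pos) (rule U)
  define f where "f = (\<lambda>n k. inverse (A n) * U n k)"
  have fpos: "0 < f n k" if "k \<in> {1..<N}" for n k unfolding f_def using U[OF that, of n] A[of n] by simp
  have massf: "mass (f n) = 1" for n
    using A[of n] unfolding f_def gap_mass_def A_def by (simp flip: sum_distrib_left)
  have f1: "\<bar>f n k\<bar> \<le> 1" if "k \<in> {1..<N}" for n k
  proof -
    have "f n k \<le> mass (f n)" unfolding gap_mass_def using that fpos[of _ n]
      by (intro member_le_sum) (auto intro: less_imp_le)
    then show ?thesis using massf fpos[OF that, of n] by simp
  qed
  obtain l and s :: "nat \<Rightarrow> nat" where s: "strict_mono s"
    and l: "\<And>k. k \<in> {1..<N} \<Longrightarrow> (\<lambda>n. f (s n) k) \<longlonglongrightarrow> l k"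
    using bounded_coordinates_convergent_subsequence[of "{1..<N}" f 1, OF _ f1] by blast
  \<comment> \<open>The total mass dominates the largest gap power, so
    \<open>A n powr (- ?q)\<close> is below the smallest gap and the mass blows up.\<close>
  have A0: "(\<lambda>n. A n powr (- ?q)) \<longlonglongrightarrow> 0"
  proof (rule tendsto_sandwich[where f = "\<lambda>_. 0" and h = "\<lambda>n. 1 / real (Suc n)"])
    show "\<forall>\<^sub>F n in sequentially. A n powr (- ?q) \<le> 1 / real (Suc n)"
    proof (intro always_eventually allI)
      fix n
      obtain k where k: "k \<in> {1..<N}" "X n (Suc k) - X n k < 1 / real (Suc n)" using small by blast
      have "U n k \<le> A n" unfolding A_def gap_mass_def
        using k U[of _ n] by (intro member_le_sum) (auto intro: less_imp_le)
      then have "A n powr (- ?q) \<le> U n k powr (- ?q)" using U[OF k(1)] m by (intro powr_mono2') auto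
      also have "\<dots> = X n (Suc k) - X n k" unfolding U_def by (rule gap_from_power[OF m o k(1)])
      finally show "A n powr (- ?q) \<le> 1 / real (Suc n)" using k by simp
    qed
    show "(\<lambda>n. 1 / real (Suc n)) \<longlonglongrightarrow> 0" by (rule LIMSEQ_Suc[OF lim_1_over_n])
  qed auto
  have A0s: "(\<lambda>n. A (s n) powr (- ?q)) \<longlonglongrightarrow> 0"
    using LIMSEQ_subseq_LIMSEQ[OF A0 s] by (simp add: o_def)
  have iA: "(\<lambda>n. inverse (A (s n))) \<longlonglongrightarrow> 0"
  proof -
    have "(\<lambda>n. (A (s n) powr (- ?q)) powr (m - 1)) \<longlonglongrightarrow> 0"
      by (rule tendsto_zero_powrI[OF A0s tendsto_const]) (use m in auto)
    moreover have "(A n powr (- ?q)) powr (m - 1) = inverse (A n)" for n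
      proof -
      have "- ?q * (m - 1) = -1" using m by simp
      then show ?thesis using A[of n] by (simp only: powr_powr) (simp add: powr_minus)
    qed
    ultimately show ?thesis by simp
  qed
  \<comment> \<open>Since \<open>chi = 1 / max_ratio\<close>, the defect from optimality of
    \<open>U n\<close> is a multiple of \<open>F (X n)\<close>. Normalising divides it by
    \<open>A n\<close>, so a bounded \<open>F\<close> leaves a vanishing defect.\<close>
  have interf: "max_ratio * (1 - (m - 1) * \<bar>K\<bar> * inverse (A n)) \<le> inter (f n)" for n
  proof -
    have "inter (f n) = inverse (A n) * inter (U n)"
      unfolding f_def using m A U by (intro interaction_scale) auto
    moreover have "inter (U n) = max_ratio * (A n - (m - 1) * F (X n))"
      unfolding U_def A_def FNm_eq[OF m o] chi_eq using m max_ratio_pos by (simp add: field_simps)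
    ultimately have "inter (f n) = max_ratio * (1 - (m - 1) * F (X n) * inverse (A n))"
      using A[of n] by (simp add: field_simps)
    moreover have "(m - 1) * F (X n) * inverse (A n) \<le> (m - 1) * \<bar>K\<bar> * inverse (A n)"
      using m A[of n] FK[of n] by (intro mult_right_mono mult_left_mono) auto
    ultimately show ?thesis using max_ratio_pos by simp
  qed
  have "max_ratio * (1 - (m - 1) * \<bar>K\<bar> * 0) \<le> inter l"
  proof (rule LIMSEQ_le)
    show "(\<lambda>n. max_ratio * (1 - (m - 1) * \<bar>K\<bar> * inverse (A (s n)))) \<longlonglongrightarrow> max_ratio * (1 - (m - 1) * \<bar>K\<bar> * 0)"
      by (intro tendsto_intros iA)
    show "(\<lambda>n. inter (f (s n))) \<longlonglongrightarrow> inter l"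
      by (rule interaction_tendsto) (use m fpos l in auto)
  qed (use interf in auto)
  moreover have massl: "mass l = 1"
  proof -
    have "(\<lambda>n. mass (f (s n))) \<longlonglongrightarrow> mass l" unfolding gap_mass_def by (intro tendsto_intros l)
    then show ?thesis using LIMSEQ_unique[OF tendsto_const] by (fastforce simp: massf)
  qed
  moreover have "0 \<le> l k" if "k \<in> {1..<N}" for k
    by (rule LIMSEQ_le_const[OF l[OF that]]) (use fpos[OF that] in \<open>auto intro: less_imp_le\<close>)
  ultimately have lpos: "0 < l k" if "k \<in> {1..<N}" for k
    using that by (intro maximiser_pos[of l]) auto
  \<comment> \<open>Each gap splits into a common factor tending to 0 and
    \<open>f (s n) k powr (- ?q)\<close>, which converges precisely because \<open>l k\<close> is
    positive.\<close>
  have gap0: "(\<lambda>n. X (s n) (Suc k) - X (s n) k) \<longlonglongrightarrow> 0" if k: "k \<in> {1..<N}" for k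
  proof -
    have "(\<lambda>n. A (s n) powr (- ?q) * f (s n) k powr (- ?q)) \<longlonglongrightarrow> 0 * l k powr (- ?q)"
      using lpos[OF k] by (intro tendsto_mult A0s tendsto_powr tendsto_const l[OF k]) auto
    moreover have "A n powr (- ?q) * f n k powr (- ?q) = X n (Suc k) - X n k" for n
    proof -
      have "A n powr (- ?q) * f n k powr (- ?q) = (A n * f n k) powr (- ?q)"
        using A[of n] fpos[OF k, of n] by (simp add: powr_mult)
      also have "A n * f n k = U n k" using A[of n] by (simp add: f_def)
      finally show ?thesis unfolding U_def by (simp only: gap_from_power[OF m o k])
    qed
    ultimately show ?thesis by simp
  qed
  have "(\<lambda>n. sqrt (real N) * (\<Sum>k=1..<N. X (s n) (Suc k) - X (s n) k)) \<longlonglongrightarrow> sqrt (real N) * (\<Sum>k=1..<N. 0)"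
    by (intro tendsto_mult tendsto_const tendsto_sum gap0)
  moreover have "r \<le> sqrt (real N) * (\<Sum>k=1..<N. X (s n) (Suc k) - X (s n) k)" for n
    using Xr[of "s n"] enorm_le_gaps[OF X, of "s n"] by linarith
  ultimately have "r \<le> sqrt (real N) * (\<Sum>k=1..<N. 0)" by (intro LIMSEQ_le_const) auto
  then show False using r by simp
qed

end

section \<open>The gradient of the energy\<close>

text \<open>Writing the absolute power as \<open>(z\<^sup>2) powr (a / 2)\<close> avoids a case
  split on the sign of \<open>z\<close>.\<close>

lemma has_real_derivative_abs_powr:
  assumes z: "(z has_real_derivative z') (at t within S)" and nz: "z t \<noteq> 0"
  shows "((\<lambda>s. \<bar>z s\<bar> powr a) has_real_derivative a * \<bar>z t\<bar> powr (a - 1) * (sgn (z t) * z')) (at t within S)"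
proof -
  have eq: "(x\<^sup>2) powr b = \<bar>x\<bar> powr (2 * b)" for x b :: real
  proof -
    have "x\<^sup>2 = \<bar>x\<bar> powr 2" by simp
    then show ?thesis by (simp only: powr_powr)
  qed
  have "((\<lambda>s. ((z s)\<^sup>2) powr (a / 2)) has_real_derivative
      (a / 2) * ((z t)\<^sup>2) powr (a / 2 - 1) * (2 * z t * z')) (at t within S)"
    using nz by (auto intro!: derivative_eq_intros z)
  moreover have "(a / 2) * ((z t)\<^sup>2) powr (a / 2 - 1) * (2 * z t * z') = a * \<bar>z t\<bar> powr (a - 1) * (sgn (z t) * z')"
  proof -
    have "\<bar>z t\<bar> powr (a - 2) * z t = \<bar>z t\<bar> powr (a - 1) * sgn (z t)"
    proof -
      have "\<bar>z t\<bar> powr (a - 1) = \<bar>z t\<bar> powr (a - 2) * \<bar>z t\<bar>"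
        using nz powr_add[of "\<bar>z t\<bar>" "a - 2" 1] by simp
      then show ?thesis by (simp add: mult.assoc abs_mult_sgn)
    qed
    then show ?thesis by (simp add: eq algebra_simps)
  qed
  ultimately show ?thesis by (simp only: eq) simp
qed

text \<open>Formulated along an arbitrary curve, so that one computation covers the flow, dilations,
  translations and moves of a single coordinate. It identifies \<open>velocity\<close> with the
  negative gradient.\<close>

lemma FNm_has_derivative:
  assumes m: "1 < m" and o: "ordered N (x t)"
    and x: "\<And>i. i \<in> {1..N} \<Longrightarrow> ((\<lambda>s. x s i) has_real_derivative w i) (at t within S)"
  shows "((\<lambda>s. FNm N m chi (x s)) has_real_derivative - (\<Sum>i=1..N. velocity N m chi (x t) i * w i))
           (at t within S)"
proof -
  let ?X = "x t"
  let ?g = "\<lambda>i. (?X (Suc i) - ?X i) powr (- m)" and ?k = "\<lambda>i j. \<bar>?X j - ?X i\<bar> powr (- m)"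
  have m0: "m - 1 \<noteq> 0" using m by simp
  have e: "1 - m - 1 = - m" by simp
  have gap: "((\<lambda>s. \<Sum>i=1..<N. (x s (Suc i) - x s i) powr (1 - m)) has_real_derivative
      (\<Sum>i=1..<N. (1 - m) * ?g i * (w (Suc i) - w i))) (at t within S)"
  proof (rule DERIV_sum)
    fix i assume i: "i \<in> {1..<N}"
    have "((\<lambda>s. x s (Suc i) - x s i) has_real_derivative w (Suc i) - w i) (at t within S)"
      using i by (intro derivative_intros x) auto
    from has_real_derivative_powr[THEN DERIV_chain2, OF _ this, of "1 - m"]
    show "((\<lambda>s. (x s (Suc i) - x s i) powr (1 - m)) has_real_derivative (1 - m) * ?g i * (w (Suc i) - w i)) (at t within S)"
      using o i by (simp add: ordered_def)
  qed
  have ne: "?X i \<noteq> ?X j" if "i \<in> {1..N}" "j \<in> {1..N} - {i}" for i j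
    using ordered_less[OF o, of i j] ordered_less[OF o, of j i] that by (auto simp: mem_pairs neq_iff)
  have int: "((\<lambda>s. \<Sum>i=1..N. \<Sum>j\<in>{1..N} - {i}. \<bar>x s i - x s j\<bar> powr (1 - m)) has_real_derivative
      (\<Sum>i=1..N. \<Sum>j\<in>{1..N} - {i}. (1 - m) * ?k j i * (sgn (?X i - ?X j) * (w i - w j)))) (at t within S)"
  proof (intro DERIV_sum)
    fix i j assume ij: "i \<in> {1..N}" "j \<in> {1..N} - {i}"
    have "((\<lambda>s. x s i - x s j) has_real_derivative w i - w j) (at t within S)"
      using ij by (intro derivative_intros x) auto
    from has_real_derivative_abs_powr[OF this, of "1 - m"] ne[OF ij]
    show "((\<lambda>s. \<bar>x s i - x s j\<bar> powr (1 - m)) has_real_derivative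
      (1 - m) * ?k j i * (sgn (?X i - ?X j) * (w i - w j))) (at t within S)" by simp
  qed
  let ?P = "\<Sum>(i,j)\<in>pairs N. ?k i j * (w i - w j)"
  let ?G = "\<Sum>i=1..<N. ?g i * (w (Suc i) - w i)"
  have int_eq: "(\<Sum>i=1..N. \<Sum>j\<in>{1..N} - {i}. (1 - m) * ?k j i * (sgn (?X i - ?X j) * (w i - w j)))
      = (1 - m) * (- 2 * ?P)"
    unfolding sum_off_diagonal sum_distrib_left
  proof (rule sum.cong[OF refl], clarify)
    fix i j assume "(i, j) \<in> pairs N"
    then have l: "?X i < ?X j" by (rule ordered_less[OF o])
    have s: "sgn (?X i - ?X j) = -1" "sgn (?X j - ?X i) = 1" using l by auto
    have k: "?k j i = ?k i j" by (simp add: abs_minus_commute)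
    show "(1 - m) * ?k j i * (sgn (?X i - ?X j) * (w i - w j)) + (1 - m) * ?k i j * (sgn (?X j - ?X i) * (w j - w i))
      = (1 - m) * (- 2 * (?k i j * (w i - w j)))"
      unfolding s k by (simp add: algebra_simps)
  qed
  have der: "((\<lambda>s. FNm N m chi (x s)) has_real_derivative
      1 / (m - 1) * (\<Sum>i=1..<N. (1 - m) * ?g i * (w (Suc i) - w i)) - chi / (m - 1) * ((1 - m) * (- 2 * ?P))) (at t within S)"
    unfolding FNm_def int_eq[symmetric] by (intro derivative_intros DERIV_cmult gap int)
  \<comment> \<open>Summation by parts: shifting the index in the left-neighbour term turns sums
    over particles into sums over gaps, and antisymmetry of the sign folds the interaction onto
    \<open>pairs\<close>.\<close>
  have vel: "(\<Sum>i=1..N. velocity N m chi ?X i * w i) = ?G + 2 * chi * ?P"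
  proof -
    have 1: "(\<Sum>i=1..N. (if i < N then - ?g i else 0) * w i) = (\<Sum>i=1..<N. - ?g i * w i)"
      by (rule sum.mono_neutral_cong_right) auto
    have 2: "(\<Sum>i=1..N. (if 1 < i then (?X i - ?X (i - 1)) powr (- m) else 0) * w i) = (\<Sum>i=1..<N. ?g i * w (Suc i))"
    proof -
      have "(\<Sum>i=1..N. (if 1 < i then (?X i - ?X (i - 1)) powr (- m) else 0) * w i)
          = (\<Sum>i=Suc 1..<Suc N. (?X i - ?X (i - 1)) powr (- m) * w i)"
        by (rule sum.mono_neutral_cong_right) auto
      also have "\<dots> = (\<Sum>i=1..<N. ?g i * w (Suc i))"
        unfolding sum.shift_bounds_Suc_ivl by simp
      finally show ?thesis .
    qed
    have 3: "(\<Sum>i=1..N. (\<Sum>j\<in>{1..N} - {i}. sgn (real j - real i) * ?k i j) * w i) = ?P"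
      unfolding sum_distrib_right sum_off_diagonal
    proof (rule sum.cong[OF refl], clarify)
      fix i j assume "(i, j) \<in> pairs N"
      then have "sgn (real j - real i) = 1" "sgn (real i - real j) = -1" "?k j i = ?k i j"
        by (auto simp: mem_pairs abs_minus_commute)
      then show "sgn (real j - real i) * ?k i j * w i + sgn (real i - real j) * ?k j i * w j = ?k i j * (w i - w j)"
        by (simp add: algebra_simps)
    qed
    have "(\<Sum>i=1..N. velocity N m chi ?X i * w i)
      = (\<Sum>i=1..N. (if i < N then - ?g i else 0) * w i)
        + (\<Sum>i=1..N. (if 1 < i then (?X i - ?X (i - 1)) powr (- m) else 0) * w i)
        + 2 * chi * (\<Sum>i=1..N. (\<Sum>j\<in>{1..N} - {i}. sgn (real j - real i) * ?k i j) * w i)"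
      unfolding velocity_def by (simp only: distrib_right sum.distrib mult.assoc sum_distrib_left[symmetric])
    also have "\<dots> = ?G + 2 * chi * ?P"
      unfolding 1 2 3 by (simp add: right_diff_distrib sum_subtractf sum_negf)
    finally show ?thesis .
  qed
  have "1 / (m - 1) * (\<Sum>i=1..<N. (1 - m) * ?g i * (w (Suc i) - w i)) = - ?G"
  proof -
    have "(\<Sum>i=1..<N. (1 - m) * ?g i * (w (Suc i) - w i)) = (1 - m) * ?G"
      by (simp add: sum_distrib_left mult.assoc)
    also have "1 / (m - 1) * ((1 - m) * ?G) = - ?G" using m0 by (simp add: field_simps)
    finally show ?thesis .
  qed
  moreover have "chi / (m - 1) * ((1 - m) * (- 2 * ?P)) = 2 * chi * ?P"
    using m0 by (simp add: field_simps)
  ultimately have "1 / (m - 1) * (\<Sum>i=1..<N. (1 - m) * ?g i * (w (Suc i) - w i)) - chi / (m - 1) * ((1 - m) * (- 2 * ?P))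
      = - (\<Sum>i=1..N. velocity N m chi ?X i * w i)"
    unfolding vel by linarith
  with der show ?thesis by simp
qed

lemma FNm_scale:
  assumes "0 < c"
  shows "FNm N m chi (\<lambda>i. c * X i) = c powr (1 - m) * FNm N m chi X"
proof -
  have *: "\<bar>c * a - c * b\<bar> = c * \<bar>a - b\<bar>" for a b
    using assms by (simp add: abs_mult flip: right_diff_distrib)
  have "(\<Sum>i=1..<N. (c * X (Suc i) - c * X i) powr (1 - m)) = c powr (1 - m) * (\<Sum>i=1..<N. (X (Suc i) - X i) powr (1 - m))"
    unfolding sum_distrib_left right_diff_distrib[symmetric] using assms by (simp add: powr_mult)
  moreover have "(\<Sum>i=1..N. \<Sum>j\<in>{1..N} - {i}. \<bar>c * X i - c * X j\<bar> powr (1 - m))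
      = c powr (1 - m) * (\<Sum>i=1..N. \<Sum>j\<in>{1..N} - {i}. \<bar>X i - X j\<bar> powr (1 - m))"
    unfolding sum_distrib_left * using assms by (simp add: powr_mult)
  ultimately show ?thesis unfolding FNm_def by (simp only: right_diff_distrib mult.left_commute)
qed

text \<open>Differentiate \<open>F\<close> along \<open>s * X\<close> at \<open>s = 1\<close> twice:
  by the chain rule and by homogeneity of degree \<open>1 - m\<close>.\<close>

lemma velocity_Euler:
  assumes m: "1 < m" and o: "ordered N X"
  shows "(\<Sum>i=1..N. velocity N m chi X i * X i) = (m - 1) * FNm N m chi X"
proof -
  have "((\<lambda>s. FNm N m chi (\<lambda>i. s * X i)) has_real_derivative - (\<Sum>i=1..N. velocity N m chi (\<lambda>i. 1 * X i) i * X i)) (at 1)"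
    by (rule FNm_has_derivative[OF m]) (use o in \<open>auto intro!: derivative_eq_intros\<close>)
  moreover have "((\<lambda>s. s powr (1 - m) * FNm N m chi X) has_real_derivative (1 - m) * FNm N m chi X) (at 1)"
    by (auto intro!: derivative_eq_intros)
  then have "((\<lambda>s. FNm N m chi (\<lambda>i. s * X i)) has_real_derivative (1 - m) * FNm N m chi X) (at 1)"
    by (rule has_field_derivative_transform_within_open[of _ _ _ "{0<..}"]) (auto simp: FNm_scale)
  ultimately have "- (\<Sum>i=1..N. velocity N m chi X i * X i) = (1 - m) * FNm N m chi X"
    using DERIV_unique by fastforce
  then show ?thesis by (simp add: algebra_simps)
qed

text \<open>This is translation invariance of \<open>F\<close>, differentiated along the shifts
  \<open>X i + s\<close>. It keeps the centre of mass at 0.\<close>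

lemma velocity_sum_zero:
  assumes m: "1 < m" and o: "ordered N X"
  shows "(\<Sum>i=1..N. velocity N m chi X i) = 0"
proof -
  have "((\<lambda>s. FNm N m chi (\<lambda>i. X i + s)) has_real_derivative - (\<Sum>i=1..N. velocity N m chi (\<lambda>i. X i + 0) i * 1)) (at 0)"
    by (rule FNm_has_derivative[OF m]) (use o in \<open>auto intro!: derivative_eq_intros\<close>)
  moreover have "(\<lambda>s. FNm N m chi (\<lambda>i. X i + s)) = (\<lambda>s. FNm N m chi X)"
    by (simp add: FNm_def)
  ultimately show ?thesis using DERIV_unique[OF _ DERIV_const] by fastforce
qed

lemma critical_point_velocity:
  assumes m: "1 < m" and o: "ordered N Z"
  shows "critical_point N m chi Z \<longleftrightarrow> (\<forall>i\<in>{1..N}. velocity N m chi Z i = 0)"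
proof -
  have D: "((\<lambda>h. FNm N m chi (Z(i := Z i + h))) has_real_derivative - velocity N m chi Z i) (at 0)"
    if i: "i \<in> {1..N}" for i
  proof -
    have "((\<lambda>h. FNm N m chi (Z(i := Z i + h))) has_real_derivative
        - (\<Sum>j=1..N. velocity N m chi (Z(i := Z i + 0)) j * (if j = i then 1 else 0))) (at 0)"
      by (rule FNm_has_derivative[OF m]) (use o in \<open>auto intro!: derivative_eq_intros\<close>)
    then show ?thesis using i by (simp add: if_distrib cong: if_cong)
  qed
  show ?thesis unfolding critical_point_def
  proof (intro ball_cong refl iffI)
    fix i assume i: "i \<in> {1..N}" and "((\<lambda>h. FNm N m chi (Z(i := Z i + h))) has_real_derivative 0) (at 0)"
    then show "velocity N m chi Z i = 0" using DERIV_unique[OF D[OF i]] by fastforce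
  next
    fix i assume "i \<in> {1..N}" "velocity N m chi Z i = 0"
    then show "((\<lambda>h. FNm N m chi (Z(i := Z i + h))) has_real_derivative 0) (at 0)"
      using D[of i] by simp
  qed
qed

section \<open>Monotone quantities along the flow\<close>

text \<open>Passing to compact time intervals removes the extended-real lifetime from the calculus
  arguments.\<close>

lemma is_solution_derivative_Icc:
  assumes "is_solution N m chi X0 X T" "0 \<le> s" "s \<le> t" "ereal t < T" "i \<in> {1..N}"
  shows "((\<lambda>r. X r i) has_real_derivative velocity N m chi (X s) i) (at s within {0..t})"
proof -
  have "ereal s < T" using assms(3,4) by (meson ereal_less_eq(3) le_less_trans)
  then have "((\<lambda>r. X r i) has_real_derivative velocity N m chi (X s) i) (at s within {s. 0 \<le> s \<and> ereal s < T})"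
    using assms by (simp add: is_solution_def)
  then show ?thesis
    by (rule DERIV_subset) (use assms(4) in \<open>auto intro: le_less_trans[of "ereal _" "ereal t"]\<close>)
qed

lemma is_solution_inRN:
  "is_solution N m chi X0 X T \<Longrightarrow> 0 \<le> t \<Longrightarrow> ereal t < T \<Longrightarrow> inRN N (X t)"
  by (simp add: is_solution_def)

lemma nonneg_derivative_Icc_mono:
  fixes f :: "real \<Rightarrow> real"
  assumes "0 \<le> a" "a \<le> b"
    and d: "\<And>s. 0 \<le> s \<Longrightarrow> s \<le> b \<Longrightarrow> (f has_real_derivative f' s) (at s within {0..b})"
    and nn: "\<And>s. 0 \<le> s \<Longrightarrow> s \<le> b \<Longrightarrow> 0 \<le> f' s"
  shows "f a \<le> f b"
proof (rule DERIV_nonneg_imp_increasing_open[OF \<open>a \<le> b\<close>])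
  fix s assume "a < s" "s < b"
  then show "\<exists>y. (f has_real_derivative y) (at s) \<and> 0 \<le> y"
    using d[of s] nn[of s] at_within_Icc_at[of 0 s b] assms(1) by (intro exI[of _ "f' s"]) auto
next
  have "continuous_on {0..b} f"
    by (rule DERIV_continuous_on[of _ _ f']) (use d in auto)
  then show "continuous_on {a..b} f" by (rule continuous_on_subset) (use assms in auto)
qed

text \<open>Along a gradient flow the derivative of the energy is minus the squared length of the
  velocity.\<close>

lemma FNm_nonincreasing:
  assumes m: "1 < m" and sol: "is_solution N m chi X0 X T" and "0 \<le> s" "s \<le> t" "ereal t < T"
  shows "FNm N m chi (X t) \<le> FNm N m chi (X s)"
proof -
  have lt: "ereal r < T" if "r \<le> t" for r
    using that assms(5) by (meson ereal_less_eq(3) le_less_trans)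
  have "- FNm N m chi (X s) \<le> - FNm N m chi (X t)"
  proof (rule nonneg_derivative_Icc_mono[OF assms(3,4)])
    fix r assume r: "0 \<le> r" "r \<le> t"
    have "((\<lambda>s. FNm N m chi (X s)) has_real_derivative
        - (\<Sum>i=1..N. velocity N m chi (X r) i * velocity N m chi (X r) i)) (at r within {0..t})"
      by (intro FNm_has_derivative m inRN_ordered is_solution_inRN[OF sol] is_solution_derivative_Icc[OF sol])
        (use r lt assms in auto)
    then show "((\<lambda>s. - FNm N m chi (X s)) has_real_derivative
        (\<Sum>i=1..N. velocity N m chi (X r) i * velocity N m chi (X r) i)) (at r within {0..t})"
      using DERIV_minus by fastforce
  qed (auto intro: sum_nonneg)
  then show ?thesis by simp
qed

lemma enorm_sq: "(enorm N X)\<^sup>2 = (\<Sum>i=1..N. (X i)\<^sup>2)"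
  by (simp add: enorm_def sum_nonneg)

lemma enorm_nonneg: "0 \<le> enorm N X"
  by (simp add: enorm_def sum_nonneg)

lemma enorm_pos:
  assumes "2 \<le> N" "inRN N X"
  shows "0 < enorm N X"
proof -
  have "X 1 < X 2" using assms by (auto simp: inRN_def numeral_2_eq_2)
  then obtain i where "i \<in> {1..N}" "X i \<noteq> 0"
    by (metis assms(1) atLeastAtMost_iff less_irrefl one_le_numeral order.refl order_trans)
  then have "0 < (\<Sum>i=1..N. (X i)\<^sup>2)" by (intro sum_pos2[of _ i]) auto
  then show ?thesis by (simp add: enorm_def)
qed

lemma enorm_scale: "0 \<le> c \<Longrightarrow> enorm N (\<lambda>i. c * X i) = c * enorm N X"
  by (simp add: enorm_def power_mult_distrib real_sqrt_mult flip: sum_distrib_left)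

lemma inRN_scale: "0 < c \<Longrightarrow> inRN N X \<Longrightarrow> inRN N (\<lambda>i. c * X i)"
  by (auto simp: inRN_def simp flip: sum_distrib_left)

text \<open>By Euler's identity, \<open>enorm\<^sup>2\<close> has derivative \<open>2 (m - 1) F\<close> along the flow.\<close>

lemma enorm_sq_growth:
  assumes m: "1 < m" and sol: "is_solution N m chi X0 X T" and t: "0 \<le> s" "s \<le> t" "ereal t < T"
    and F: "\<And>r. 0 \<le> r \<Longrightarrow> r \<le> t \<Longrightarrow> e \<le> FNm N m chi (X r)"
  shows "(enorm N (X s))\<^sup>2 + 2 * (m - 1) * e * (t - s) \<le> (enorm N (X t))\<^sup>2"
proof -
  have lt: "ereal r < T" if "r \<le> t" for r
    using that t(3) by (meson ereal_less_eq(3) le_less_trans)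
  \<comment> \<open>Subtracting the linear term reduces the growth estimate to monotonicity. The
    case \<open>e = 0\<close> keeps the norm from shrinking; \<open>e > 0\<close> forces linear
    growth.\<close>
  have "(\<Sum>i=1..N. (X s i)\<^sup>2) - 2 * (m - 1) * e * s \<le> (\<Sum>i=1..N. (X t i)\<^sup>2) - 2 * (m - 1) * e * t"
  proof (rule nonneg_derivative_Icc_mono[OF t(1,2)])
    fix r assume r: "0 \<le> r" "r \<le> t"
    have o: "ordered N (X r)" using r lt by (intro inRN_ordered is_solution_inRN[OF sol]) auto
    have "((\<lambda>s. \<Sum>i=1..N. (X s i)\<^sup>2) has_real_derivative
        (\<Sum>i=1..N. 2 * (velocity N m chi (X r) i * X r i))) (at r within {0..t})"
      using is_solution_derivative_Icc[OF sol r t(3)]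
      by (intro DERIV_sum) (auto intro!: derivative_eq_intros)
    then have "((\<lambda>s. (\<Sum>i=1..N. (X s i)\<^sup>2) - 2 * (m - 1) * e * s) has_real_derivative
        (\<Sum>i=1..N. 2 * (velocity N m chi (X r) i * X r i)) - 2 * (m - 1) * e * 1) (at r within {0..t})"
      by (intro DERIV_diff DERIV_cmult DERIV_ident)
    moreover have "(\<Sum>i=1..N. 2 * (velocity N m chi (X r) i * X r i)) = 2 * ((m - 1) * FNm N m chi (X r))"
      unfolding velocity_Euler[OF m o, symmetric] by (rule sum_distrib_left[symmetric])
    ultimately have "((\<lambda>s. (\<Sum>i=1..N. (X s i)\<^sup>2) - 2 * (m - 1) * e * s) has_real_derivative
        2 * ((m - 1) * FNm N m chi (X r)) - 2 * (m - 1) * e * 1) (at r within {0..t})" by (simp only:)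
    then show "((\<lambda>s. (\<Sum>i=1..N. (X s i)\<^sup>2) - 2 * (m - 1) * e * s) has_real_derivative
        2 * (m - 1) * (FNm N m chi (X r) - e)) (at r within {0..t})"
      by (rule DERIV_cong) (simp add: algebra_simps)
    show "0 \<le> 2 * (m - 1) * (FNm N m chi (X r) - e)" using F[OF r] m by simp
  qed
  then show ?thesis by (simp add: enorm_sq algebra_simps)
qed

section \<open>Critical points as minimisers of the energy\<close>

context critical_gradient_flow
begin

text \<open>A critical point annihilates the left side of Euler's identity, hence \<open>F\<close>.
  Conversely \<open>F\<close> is nonnegative on ordered vectors, so a zero is a local minimum in
  each coordinate.\<close>

lemma critical_point_iff:
  assumes Z: "inRN N Z"
  shows "critical_point N m chi Z \<longleftrightarrow> F Z = 0"
proof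
  note o = inRN_ordered[OF Z]
  assume "critical_point N m chi Z"
  then have "(\<Sum>i=1..N. velocity N m chi Z i * Z i) = 0"
    unfolding critical_point_velocity[OF m o] by (intro sum.neutral) auto
  then show "F Z = 0" using velocity_Euler[OF m o, of chi] m by simp
next
  note o = inRN_ordered[OF Z]
  assume F0: "F Z = 0"
  \<comment> \<open>Moving one coordinate by less than the smallest gap preserves the order, hence
    the nonnegativity of \<open>F\<close>.\<close>
  define d where "d = Min ((\<lambda>k. Z (Suc k) - Z k) ` {1..<N})"
  have ne: "(\<lambda>k. Z (Suc k) - Z k) ` {1..<N} \<noteq> {}" using N by auto
  have "0 < d" unfolding d_def using o ne by (subst Min_gr_iff) (auto simp: ordered_def)
  have d: "d \<le> Z (Suc k) - Z k" if "k \<in> {1..<N}" for k unfolding d_def using that by (intro Min_le) auto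
  show "critical_point N m chi Z"
    unfolding critical_point_def
  proof
    fix i assume i: "i \<in> {1..N}"
    have "((\<lambda>h. F (Z(i := Z i + h))) has_real_derivative
        - (\<Sum>j=1..N. velocity N m chi (Z(i := Z i + 0)) j * (if j = i then 1 else 0))) (at 0)"
      (is "(_ has_real_derivative ?D) _")
      by (rule FNm_has_derivative[OF m]) (use o in \<open>auto intro!: derivative_eq_intros\<close>)
    moreover from this have "?D = 0"
    proof (rule DERIV_local_min[OF _ \<open>0 < d\<close>], intro allI impI)
      fix h :: real assume "\<bar>0 - h\<bar> < d"
      then have "ordered N (Z(i := Z i + h))"
        unfolding ordered_def using d by (auto simp: abs_less_iff) force+
      then show "F (Z(i := Z i + 0)) \<le> F (Z(i := Z i + h))" using F0 F_nonneg by simp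
    qed
    ultimately show "((\<lambda>h. F (Z(i := Z i + h))) has_real_derivative 0) (at 0)" by simp
  qed
qed

lemma solution_sublevel:
  assumes sol: "is_solution N m chi X0 X T" and t: "0 \<le> t" "ereal t < T"
  shows "F (X t) \<le> F X0" and "enorm N X0 \<le> enorm N (X t)"
proof -
  have X0: "X 0 = X0" using sol by (simp add: is_solution_def)
  show "F (X t) \<le> F X0" using FNm_nonincreasing[OF m sol _ t(1) t(2)] X0 by auto
  have "(enorm N (X 0))\<^sup>2 + 2 * (m - 1) * 0 * (t - 0) \<le> (enorm N (X t))\<^sup>2"
  proof (rule enorm_sq_growth[OF m sol])
    fix r assume r: "0 \<le> r" "r \<le> t"
    then have "ereal r < T" using t by (meson ereal_less_eq(3) le_less_trans)
    then show "0 \<le> F (X r)" using r by (intro F_nonneg inRN_ordered is_solution_inRN[OF sol])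
  qed (use t in auto)
  then show "enorm N X0 \<le> enorm N (X t)" using X0 enorm_nonneg power2_le_imp_le by auto
qed

end

section \<open>Global solutions and convergence\<close>

instance bcontfun :: (metric_space, banach) banach ..

lemma bounded_linear_apply_bcontfun:
  "bounded_linear (\<lambda>x :: 'a::topological_space \<Rightarrow>\<^sub>C real. apply_bcontfun x i)"
proof (rule bounded_linear_intro[where K = 1])
  show "norm (apply_bcontfun x i) \<le> norm x * 1" for x :: "'a \<Rightarrow>\<^sub>C real"
    using norm_bounded[of x i] by simp
qed auto

text \<open>Coordinates are embedded into the Banach space of bounded functions on a discrete space,
  since the dimension is not a type here.\<close>

lemma global_solution_coordinates:
  fixes g :: "('a \<Rightarrow> real) \<Rightarrow> 'a \<Rightarrow> real" and x0 :: "'a \<Rightarrow> real"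
  assumes J: "finite J" and L: "0 \<le> L"
    and lip: "\<And>u v i. i \<in> J \<Longrightarrow> \<bar>g u i - g v i\<bar> \<le> L * (\<Sum>j\<in>J. \<bar>u j - v j\<bar>)"
  shows "\<exists>x. (\<forall>i. x 0 i = (if i \<in> J then x0 i else 0)) \<and> (\<forall>t i. i \<notin> J \<longrightarrow> x t i = 0) \<and>
    (\<forall>t\<ge>0. \<forall>i\<in>J. ((\<lambda>s. x s i) has_real_derivative g (x t) i) (at t within {0..}))"
proof -
  let ?ext = "\<lambda>h :: 'a \<Rightarrow> real. \<lambda>i. if of_discrete i \<in> J then h (of_discrete i) else 0"
  have ext_bcontfun: "?ext h \<in> bcontfun" for h
  proof (rule bcontfun_normI)
    show "norm (?ext h i) \<le> (\<Sum>j\<in>J. \<bar>h j\<bar>)" for i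
      using J member_le_sum[of "of_discrete i" J "\<lambda>j. \<bar>h j\<bar>"] by (auto intro: sum_nonneg)
  qed (simp add: continuous_on_open_vimage open_discrete)
  define emb where "emb = (\<lambda>h. Bcontfun (?ext h))"
  have emb: "apply_bcontfun (emb h) = ?ext h" for h
    unfolding emb_def by (rule Bcontfun_inverse[OF ext_bcontfun])
  define res :: "('a discrete \<Rightarrow>\<^sub>C real) \<Rightarrow> 'a \<Rightarrow> real" where "res = (\<lambda>y i. apply_bcontfun y (discrete i))"
  define f where "f = (\<lambda>y. emb (g (res y)))"
  have lipf: "norm (f y - f z) \<le> L * real (card J) * norm (y - z)" for y z
  proof (rule norm_bound)
    fix i
    have "(\<Sum>j\<in>J. \<bar>res y j - res z j\<bar>) \<le> (\<Sum>j\<in>J. norm (y - z))"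
      using norm_bounded[of "y - z"] by (intro sum_mono) (simp add: res_def)
    then have "L * (\<Sum>j\<in>J. \<bar>res y j - res z j\<bar>) \<le> L * (real (card J) * norm (y - z))"
      using L by (intro mult_left_mono) auto
    then show "norm (apply_bcontfun (f y - f z) i) \<le> L * real (card J) * norm (y - z)"
      using order_trans[OF lip[of "of_discrete i" "res y" "res z"]] L
      by (simp add: f_def emb mult.assoc)
  qed
  have "0 \<le> L * real (card J)" using L by simp
  from global_solution_of_lipschitz_ode[OF this lipf, of "emb x0"]
  obtain y where y0: "y 0 = emb x0"
    and y: "\<And>t. 0 \<le> t \<Longrightarrow> (y has_vector_derivative f (y t)) (at t within {0..})" by auto
  define x where "x = (\<lambda>t i. if i \<in> J then res (y t) i else 0)"
  have "((\<lambda>s. x s i) has_real_derivative g (x t) i) (at t within {0..})" if t: "0 \<le> t" and i: "i \<in> J" for t i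
  proof -
    have "((\<lambda>s. res (y s) i) has_vector_derivative res (f (y t)) i) (at t within {0..})"
      unfolding res_def
      by (rule bounded_linear.has_vector_derivative[OF bounded_linear_apply_bcontfun y[OF t]])
    moreover have "res (f (y t)) i = g (x t) i"
    proof -
      have "(\<Sum>j\<in>J. \<bar>res (y t) j - x t j\<bar>) = 0" by (simp add: x_def)
      then have "g (res (y t)) i = g (x t) i" using lip[OF i, of "res (y t)" "x t"] by simp
      then show ?thesis using i unfolding f_def by (subst res_def) (simp add: emb discrete_inverse)
    qed
    ultimately show ?thesis using i by (simp add: x_def has_real_derivative_iff_has_vector_derivative)
  qed
  moreover have "x 0 i = (if i \<in> J then x0 i else 0)" for i
    by (simp add: x_def y0 res_def emb discrete_inverse)
  moreover have "x t i = 0" if "i \<notin> J" for t i using that by (simp add: x_def)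
  ultimately show ?thesis by blast
qed

section \<open>Truncation of the singular field, uniqueness and global existence\<close>

text \<open>Bounding all distances from below by \<open>d\<close> makes the field globally
  Lipschitz. Signs are taken from the indices, as in \<open>velocity\<close>, so it makes sense off
  the ordered cone as well.\<close>

definition truncated_velocity :: "nat \<Rightarrow> real \<Rightarrow> real \<Rightarrow> real \<Rightarrow> (nat \<Rightarrow> real) \<Rightarrow> nat \<Rightarrow> real" where
  "truncated_velocity N m chi d X i =
     (if i < N then - (max d (X (Suc i) - X i) powr (- m)) else 0)
     + (if 1 < i then max d (X i - X (i - 1)) powr (- m) else 0)
     + 2 * chi * (\<Sum>j\<in>{1..N} - {i}. sgn (real j - real i) * max d \<bar>X j - X i\<bar> powr (- m))"

text \<open>Any two particles are at least as far apart as some neighbouring pair between them, so a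
  bound on neighbouring gaps disables every \<open>max d\<close>.\<close>

lemma truncated_velocity_eq:
  assumes d: "0 < d" and gaps: "\<And>k. k \<in> {1..<N} \<Longrightarrow> d \<le> X (Suc k) - X k" and i: "i \<in> {1..N}"
  shows "truncated_velocity N m chi d X i = velocity N m chi X i"
proof -
  have dist: "d \<le> X b - X a" if "(a, b) \<in> pairs N" for a b
  proof -
    have "X (Suc a) - X a \<le> (\<Sum>k=a..<b. X (Suc k) - X k)"
    proof (rule member_le_sum)
      fix k assume "k \<in> {a..<b} - {a}"
      then show "0 \<le> X (Suc k) - X k" using gaps[of k] that d by (auto simp: mem_pairs)
    qed (use that in \<open>auto simp: mem_pairs\<close>)
    also have "\<dots> = X b - X a" using that by (intro gaps_telescope) (simp add: mem_pairs)
    finally show ?thesis using gaps[of a] that by (auto simp: mem_pairs)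
  qed
  have "max d \<bar>X j - X i\<bar> = \<bar>X j - X i\<bar>" if "j \<in> {1..N} - {i}" for j
    using dist[of i j] dist[of j i] that i by (cases "i < j") (auto simp: mem_pairs)
  moreover have "max d (X (Suc i) - X i) = X (Suc i) - X i" if "i < N"
    using dist[of i "Suc i"] that i by (auto simp: mem_pairs)
  moreover have "max d (X i - X (i - 1)) = X i - X (i - 1)" if "1 < i"
    using dist[of "i - 1" i] that i by (auto simp: mem_pairs)
  ultimately show ?thesis unfolding truncated_velocity_def velocity_def by simp
qed

text \<open>The constant is the slope of \<open>x powr (- r)\<close> at \<open>d\<close>, its
  steepest point on \<open>[d, \<infinity>)\<close>; the tangent inequality replaces the mean value
  theorem.\<close>

lemma max_powr_minus_lipschitz:
  fixes a b d r :: real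
  assumes d: "0 < d" and r: "0 < r"
  shows "\<bar>max d a powr (- r) - max d b powr (- r)\<bar> \<le> r * d powr (- r - 1) * \<bar>a - b\<bar>"
proof -
  have *: "x powr (- r) - y powr (- r) \<le> r * d powr (- r - 1) * \<bar>x - y\<bar>" if "d \<le> x" "d \<le> y" for x y
  proof -
    have "x powr (- r) - y powr (- r) \<le> r * x powr (- r - 1) * (y - x)"
      using powr_minus_above_tangent(1)[of x y r] that d r by simp
    also have "\<dots> \<le> r * x powr (- r - 1) * \<bar>x - y\<bar>"
      using r by (intro mult_left_mono) auto
    also have "\<dots> \<le> r * d powr (- r - 1) * \<bar>x - y\<bar>"
      using that d r by (intro mult_right_mono mult_left_mono powr_mono2') auto
    finally show ?thesis .
  qed
  have "\<bar>max d a powr (- r) - max d b powr (- r)\<bar> \<le> r * d powr (- r - 1) * \<bar>max d a - max d b\<bar>"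
    using *[of "max d a" "max d b"] *[of "max d b" "max d a"] by (simp add: abs_le_iff abs_minus_commute)
  also have "\<dots> \<le> r * d powr (- r - 1) * \<bar>a - b\<bar>"
    using r by (intro mult_left_mono) (auto simp: max_def)
  finally show ?thesis .
qed

lemma truncated_velocity_lipschitz:
  assumes m: "0 < m" and d: "0 < d" and chi: "0 \<le> chi"
  shows "\<exists>L\<ge>0. \<forall>X Y. \<forall>i\<in>{1..N}.
    \<bar>truncated_velocity N m chi d X i - truncated_velocity N m chi d Y i\<bar> \<le> L * (\<Sum>j=1..N. \<bar>X j - Y j\<bar>)"
proof (intro exI conjI allI ballI)
  define C where "C = m * d powr (- m - 1)"
  \<comment> \<open>Each distance changes by at most \<open>2 * ?D\<close>, hence each power by
    \<open>2 * C * ?D\<close>. The two neighbour terms give \<open>4 * C\<close>, the at most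
    \<open>N\<close> interaction terms with weight \<open>2 * chi\<close> give the rest.\<close>
  define L where "L = (4 + 4 * chi * real N) * C"
  have C: "0 \<le> C" using m by (simp add: C_def)
  show "0 \<le> L" using C chi by (simp add: L_def)
  fix X Y :: "nat \<Rightarrow> real" and i assume i: "i \<in> {1..N}"
  let ?D = "\<Sum>j=1..N. \<bar>X j - Y j\<bar>"
  have coord: "\<bar>X a - Y a\<bar> \<le> ?D" if "a \<in> {1..N}" for a
    using that by (intro member_le_sum) auto
  have D0: "0 \<le> ?D" by (intro sum_nonneg) auto
  have term_le: "\<bar>max d a powr (- m) - max d b powr (- m)\<bar> \<le> 2 * C * ?D" if "\<bar>a - b\<bar> \<le> 2 * ?D" for a b
  proof -
    have "\<bar>max d a powr (- m) - max d b powr (- m)\<bar> \<le> C * \<bar>a - b\<bar>"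
      unfolding C_def using m d by (intro max_powr_minus_lipschitz) auto
    also have "\<dots> \<le> C * (2 * ?D)" using that C by (intro mult_left_mono)
    finally show ?thesis by simp
  qed
  let ?t1 = "\<lambda>X. if i < N then - (max d (X (Suc i) - X i) powr (- m)) else 0"
  let ?t2 = "\<lambda>X. if 1 < i then max d (X i - X (i - 1)) powr (- m) else 0"
  let ?t3 = "\<lambda>X j. sgn (real j - real i) * max d \<bar>X j - X i\<bar> powr (- m)"
  have CD: "0 \<le> 2 * C * ?D" using C D0 by simp
  have t1: "\<bar>?t1 X - ?t1 Y\<bar> \<le> 2 * C * ?D"
  proof (cases "i < N")
    case True
    then have "\<bar>max d (X (Suc i) - X i) powr (- m) - max d (Y (Suc i) - Y i) powr (- m)\<bar> \<le> 2 * C * ?D"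
      using coord[of i] coord[of "Suc i"] i by (intro term_le) auto
    then show ?thesis using True by (simp add: abs_minus_commute)
  qed (use CD in simp)
  have t2: "\<bar>?t2 X - ?t2 Y\<bar> \<le> 2 * C * ?D"
  proof (cases "1 < i")
    case True
    then have "\<bar>max d (X i - X (i - 1)) powr (- m) - max d (Y i - Y (i - 1)) powr (- m)\<bar> \<le> 2 * C * ?D"
      using coord[of i] coord[of "i - 1"] i by (intro term_le) force
    then show ?thesis using True by simp
  qed (use CD in simp)
  have "\<bar>(\<Sum>j\<in>{1..N} - {i}. ?t3 X j) - (\<Sum>j\<in>{1..N} - {i}. ?t3 Y j)\<bar> \<le> (\<Sum>j\<in>{1..N} - {i}. \<bar>?t3 X j - ?t3 Y j\<bar>)"
    unfolding sum_subtractf[symmetric] by (rule sum_abs)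
  also have "\<dots> \<le> (\<Sum>j\<in>{1..N} - {i}. 2 * C * ?D)"
  proof (rule sum_mono)
    fix j assume j: "j \<in> {1..N} - {i}"
    have "\<bar>max d \<bar>X j - X i\<bar> powr (- m) - max d \<bar>Y j - Y i\<bar> powr (- m)\<bar> \<le> 2 * C * ?D"
      using coord[of i] coord[of j] i j by (intro term_le) auto
    moreover have "\<bar>sgn (real j - real i)\<bar> = 1" using j by (auto simp: abs_sgn_eq)
    ultimately show "\<bar>?t3 X j - ?t3 Y j\<bar> \<le> 2 * C * ?D"
      by (simp add: abs_mult flip: right_diff_distrib)
  qed
  also have "\<dots> \<le> real N * (2 * C * ?D)"
    using CD i by (simp add: mult_right_mono)
  finally have t3: "\<bar>(\<Sum>j\<in>{1..N} - {i}. ?t3 X j) - (\<Sum>j\<in>{1..N} - {i}. ?t3 Y j)\<bar> \<le> real N * (2 * C * ?D)" .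
  have "\<bar>2 * chi * (\<Sum>j\<in>{1..N} - {i}. ?t3 X j) - 2 * chi * (\<Sum>j\<in>{1..N} - {i}. ?t3 Y j)\<bar>
      = 2 * chi * \<bar>(\<Sum>j\<in>{1..N} - {i}. ?t3 X j) - (\<Sum>j\<in>{1..N} - {i}. ?t3 Y j)\<bar>"
    unfolding right_diff_distrib[symmetric] using chi by (simp add: abs_mult)
  also have "\<dots> \<le> 2 * chi * (real N * (2 * C * ?D))"
    using chi t3 by (intro mult_left_mono) auto
  finally have t3': "\<bar>2 * chi * (\<Sum>j\<in>{1..N} - {i}. ?t3 X j) - 2 * chi * (\<Sum>j\<in>{1..N} - {i}. ?t3 Y j)\<bar>
      \<le> 2 * chi * (real N * (2 * C * ?D))" .
  have add3: "\<bar>a + b + c - (a' + b' + c')\<bar> \<le> r + s + q"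
    if "\<bar>a - a'\<bar> \<le> r" "\<bar>b - b'\<bar> \<le> s" "\<bar>c - c'\<bar> \<le> q" for a b c a' b' c' r s q :: real
    using that by linarith
  have "\<bar>truncated_velocity N m chi d X i - truncated_velocity N m chi d Y i\<bar>
      \<le> 2 * C * ?D + 2 * C * ?D + 2 * chi * (real N * (2 * C * ?D))"
    unfolding truncated_velocity_def by (rule add3[OF t1 t2 t3'])
  also have "\<dots> = L * ?D" by (simp add: L_def algebra_simps)
  finally show "\<bar>truncated_velocity N m chi d X i - truncated_velocity N m chi d Y i\<bar> \<le> L * ?D" .
qed

context critical_gradient_flow
begin

text \<open>Both inequalities on \<open>X\<close> are propagated by the flow from \<open>X0\<close>,
  so a single \<open>d\<close> serves every solution at all times.\<close>

definition uniform_gap :: "(nat \<Rightarrow> real) \<Rightarrow> real \<Rightarrow> bool" where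
  "uniform_gap X0 d \<longleftrightarrow> 0 < d \<and> (\<forall>X. inRN N X \<and> F X \<le> F X0 \<and> enorm N X0 \<le> enorm N X \<longrightarrow>
     (\<forall>k\<in>{1..<N}. d \<le> X (Suc k) - X k))"

lemma uniform_gap_exists: "inRN N X0 \<Longrightarrow> \<exists>d. uniform_gap X0 d"
  unfolding uniform_gap_def using gaps_bounded_below[OF enorm_pos[OF N]] by blast

lemma solution_gap:
  assumes "uniform_gap X0 d" "is_solution N m chi X0 X T" "0 \<le> t" "ereal t < T" "k \<in> {1..<N}"
  shows "d \<le> X t (Suc k) - X t k"
  using assms solution_sublevel[OF assms(2-4)] is_solution_inRN[OF assms(2-4)]
  unfolding uniform_gap_def by blast

text \<open>Both solutions keep their gaps at least \<open>d\<close> on \<open>{0..t}\<close>, so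
  there they solve the same system truncated at \<open>d\<close>, which is Lipschitz.\<close>

lemma solution_unique:
  assumes X0: "inRN N X0" and X: "is_solution N m chi X0 X T" and Y: "is_solution N m chi X0 Y T'"
    and t: "0 \<le> t" "ereal t < T" "ereal t < T'"
  shows "X t = Y t"
proof
  fix i
  obtain d where d: "uniform_gap X0 d" using uniform_gap_exists[OF X0] by blast
  then have d0: "0 < d" by (simp add: uniform_gap_def)
  obtain L where L: "0 \<le> L" and lip: "\<And>X Y i. i \<in> {1..N} \<Longrightarrow>
      \<bar>truncated_velocity N m chi d X i - truncated_velocity N m chi d Y i\<bar> \<le> L * (\<Sum>j=1..N. \<bar>X j - Y j\<bar>)"
    using truncated_velocity_lipschitz[of m d chi N] m d0 chi_pos by auto
  have der: "((\<lambda>r. Z r i) has_real_derivative truncated_velocity N m chi d (Z s) i) (at s within {0..t})"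
    if Z: "is_solution N m chi X0 Z S" and S: "ereal t < S" and s: "0 \<le> s" "s \<le> t" and i: "i \<in> {1..N}" for Z S s i
  proof -
    have "ereal s < S" using S s by (meson ereal_less_eq(3) le_less_trans)
    then show ?thesis
      using is_solution_derivative_Icc[OF Z s S i]
        truncated_velocity_eq[of d N "Z s" i m chi, OF d0 solution_gap[OF d Z s(1)] i] by simp
  qed
  show "X t i = Y t i"
  proof (cases "i \<in> {1..N}")
    case True
    show ?thesis
      by (rule lipschitz_ode_unique[OF _ L lip t(1) der[OF X t(2)] der[OF Y t(3)] _ True])
        (use X Y in \<open>auto simp: is_solution_def\<close>)
  next
    case False
    then show ?thesis using is_solution_inRN[OF X t(1,2)] is_solution_inRN[OF Y t(1,3)] by (simp add: inRN_def)
  qed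
qed

text \<open>The flow of the truncated field never sees the truncation: as long as all gaps exceed
  \<open>d / 2\<close> it is the true flow, for which they are in fact at least \<open>d\<close>.\<close>

lemma global_solution_exists:
  assumes X0: "inRN N X0"
  shows "\<exists>X. is_solution N m chi X0 X \<infinity>"
proof -
  obtain d where d: "uniform_gap X0 d" using uniform_gap_exists[OF X0] by blast
  then have d0: "0 < d" by (simp add: uniform_gap_def)
  obtain L where L: "0 \<le> L" and lip: "\<And>X Y i. i \<in> {1..N} \<Longrightarrow>
      \<bar>truncated_velocity N m chi (d / 2) X i - truncated_velocity N m chi (d / 2) Y i\<bar> \<le> L * (\<Sum>j=1..N. \<bar>X j - Y j\<bar>)"
    using truncated_velocity_lipschitz[of m "d / 2" chi N] m d0 chi_pos by auto
  from global_solution_coordinates[of "{1..N}" L "truncated_velocity N m chi (d / 2)" X0, OF finite_atLeastAtMost L lip]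
  obtain x where x0: "\<forall>i. x 0 i = (if i \<in> {1..N} then X0 i else 0)"
    and x_out: "\<forall>t i. i \<notin> {1..N} \<longrightarrow> x t i = 0"
    and x_der: "\<forall>t\<ge>0. \<forall>i\<in>{1..N}.
      ((\<lambda>s. x s i) has_real_derivative truncated_velocity N m chi (d / 2) (x t) i) (at t within {0..})"
    by auto
  note x = x_der[rule_format]
  have x0': "x 0 = X0" using x0 X0 by (auto simp: inRN_def)
  define gap where "gap = (\<lambda>k t. x t (Suc k) - x t k)"
  have cont: "continuous_on {0..} (gap k)" if "k \<in> {1..<N}" for k
  proof -
    have "continuous_on {0..} (\<lambda>t. x t i)" if "i \<in> {1..N}" for i
      by (rule DERIV_continuous_on) (use x[OF _ that] in auto)
    then show ?thesis unfolding gap_def using that by (intro continuous_intros) auto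
  qed
  \<comment> \<open>Kept general in \<open>T\<close>, because it is applied twice: up to the first
    bad time, and then for \<open>\<infinity>\<close>.\<close>
  have sol: "is_solution N m chi X0 x T"
    if T: "0 < T" and gaps: "\<And>t k. 0 \<le> t \<Longrightarrow> ereal t < T \<Longrightarrow> k \<in> {1..<N} \<Longrightarrow> d / 2 < gap k t" for T
  proof -
    have o: "ordered N (x t)" if "0 \<le> t" "ereal t < T" for t
      using gaps[OF that] d0 by (force simp: ordered_def gap_def)
    have vel: "truncated_velocity N m chi (d / 2) (x t) i = velocity N m chi (x t) i"
      if "0 \<le> t" "ereal t < T" "i \<in> {1..N}" for t i
      by (rule truncated_velocity_eq) (use d0 gaps[OF that(1,2)] that in \<open>auto simp: gap_def less_imp_le\<close>)
    have "(\<Sum>i=1..N. x t i) = 0" if t: "0 \<le> t" "ereal t < T" for t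
    proof -
      have "\<exists>c. \<forall>s\<in>{0..t}. (\<Sum>i=1..N. x s i) = c"
      proof (rule has_field_derivative_zero_constant)
        fix s assume s: "s \<in> {0..t}"
        then have sT: "0 \<le> s" "ereal s < T" using t by (auto intro: le_less_trans[of "ereal _" "ereal t"])
        have "((\<lambda>s. \<Sum>i=1..N. x s i) has_real_derivative (\<Sum>i=1..N. velocity N m chi (x s) i)) (at s within {0..t})"
        proof (rule DERIV_sum)
          fix i assume i: "i \<in> {1..N}"
          show "((\<lambda>s. x s i) has_real_derivative velocity N m chi (x s) i) (at s within {0..t})"
            using DERIV_subset[OF x[OF sT(1) i], of "{0..t}"] vel[OF sT i] by auto
        qed
        then show "((\<lambda>s. \<Sum>i=1..N. x s i) has_real_derivative 0) (at s within {0..t})"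
          using velocity_sum_zero[OF m o[OF sT]] by simp
      qed simp
      then obtain c where c: "\<And>s. s \<in> {0..t} \<Longrightarrow> (\<Sum>i=1..N. x s i) = c" by blast
      have "(\<Sum>i=1..N. x t i) = (\<Sum>i=1..N. x 0 i)" using c[of t] c[of 0] t by simp
      then show ?thesis using X0 x0' by (simp add: inRN_def)
    qed
    then have "inRN N (x t)" if "0 \<le> t" "ereal t < T" for t
      using o[OF that] x_out that by (simp add: inRN_def ordered_def)
    moreover have "((\<lambda>s. x s i) has_real_derivative velocity N m chi (x t) i) (at t within {s. 0 \<le> s \<and> ereal s < T})"
      if "0 \<le> t" "ereal t < T" "i \<in> {1..N}" for t i
      using DERIV_subset[OF x[OF that(1,3)], of "{s. 0 \<le> s \<and> ereal s < T}"] vel[OF that] by auto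
    ultimately show ?thesis using T x0' unfolding is_solution_def by blast
  qed
  \<comment> \<open>A finite union of closed sets of times, so a first bad time exists if there is
    any.\<close>
  define bad where "bad = (\<Union>k\<in>{1..<N}. {t \<in> {0..}. gap k t \<le> d / 2})"
  have "bad = {}"
  proof (rule ccontr)
    assume ne: "bad \<noteq> {}"
    have cl: "closed bad" unfolding bad_def
      by (intro closed_UN ballI continuous_on_closed_Collect_le cont continuous_on_const) auto
    have bdd: "bdd_below bad" by (rule bdd_belowI[of _ 0]) (auto simp: bad_def)
    define \<tau> where "\<tau> = Inf bad"
    have "\<tau> \<in> bad" unfolding \<tau>_def by (rule closed_contains_Inf[OF ne bdd cl])
    then obtain k where k: "k \<in> {1..<N}" "gap k \<tau> \<le> d / 2" and "0 \<le> \<tau>" by (auto simp: bad_def)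
    \<comment> \<open>\<open>X0\<close> satisfies its own sublevel conditions, so the first bad time
      is strictly positive.\<close>
    have "d \<le> gap k 0" using d X0 k(1) x0' by (auto simp: uniform_gap_def gap_def)
    then have "\<tau> \<noteq> 0" using k(2) d0 by auto
    then have \<tau>: "0 < \<tau>" using \<open>0 \<le> \<tau>\<close> by simp
    have "is_solution N m chi X0 x (ereal \<tau>)"
    proof (rule sol)
      fix t k' assume t: "0 \<le> t" "ereal t < ereal \<tau>" "k' \<in> {1..<N}"
      then have "t \<notin> bad" using cInf_lower[OF _ bdd, of t] by (auto simp: \<tau>_def)
      then show "d / 2 < gap k' t" using t by (auto simp: bad_def not_le)
    qed (use \<tau> in simp)
    \<comment> \<open>Before the first bad time the flow is genuine and its gaps are at least
      \<open>d\<close>; by continuity so is the gap at that time, against the bound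
      \<open>d / 2\<close>.\<close>
    from solution_gap[OF d this] have ge: "d \<le> gap k t" if "t \<in> {0..<\<tau>}" for t
      using that k(1) by (simp add: gap_def)
    have cl': "closure {0..<\<tau>} = {0..\<tau>}" using \<tau> by simp
    have "d \<le> gap k \<tau>"
      by (rule continuous_ge_on_closure[of "{0..<\<tau>}" "gap k"])
        (use ge \<tau> cl' continuous_on_subset[OF cont[OF k(1)]] in auto)
    then show False using k(2) d0 by simp
  qed
  then have "is_solution N m chi X0 x \<infinity>"
    by (intro sol) (auto simp: bad_def not_le[symmetric])
  then show ?thesis by blast
qed

section \<open>Convergence of bounded trajectories\<close>

lemma abs_le_enorm: "i \<in> {1..N} \<Longrightarrow> \<bar>X i\<bar> \<le> enorm N X"
  unfolding enorm_def by (rule real_le_rsqrt) (auto intro: member_le_sum[where f = "\<lambda>i. (X i)\<^sup>2"])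

text \<open>Since \<open>F\<close> decreases, failure would mean \<open>F \<ge> e\<close> at all
  times, and then \<open>enorm\<^sup>2\<close> grows linearly past any bound.\<close>

lemma F_small_of_bounded:
  assumes sol: "is_solution N m chi X0 X \<infinity>" and B: "\<And>t. 0 \<le> t \<Longrightarrow> enorm N (X t) \<le> B" and e: "0 < e"
  shows "\<exists>t0\<ge>0. \<forall>t\<ge>t0. F (X t) \<le> e"
proof (rule ccontr)
  assume neg: "\<not> ?thesis"
  have large: "e \<le> F (X r)" if r: "0 \<le> r" for r
  proof -
    obtain t where "r \<le> t" "e < F (X t)" using neg r by (meson not_le)
    then show ?thesis using FNm_nonincreasing[OF m sol r, of t] by simp
  qed
  \<comment> \<open>Chosen so that the guaranteed growth up to \<open>t\<close> is
    \<open>B\<^sup>2 + 1\<close>.\<close>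
  define t where "t = (B\<^sup>2 + 1) / (2 * (m - 1) * e)"
  have c: "0 < 2 * (m - 1) * e" using m e by simp
  have t: "0 \<le> t" unfolding t_def using c by (intro divide_nonneg_pos) auto
  have "(enorm N (X 0))\<^sup>2 + 2 * (m - 1) * e * (t - 0) \<le> (enorm N (X t))\<^sup>2"
    by (rule enorm_sq_growth[OF m sol]) (use t large in auto)
  also have "\<dots> \<le> B\<^sup>2" using B[OF t] enorm_nonneg by (intro power_mono)
  finally have "2 * (m - 1) * e * t \<le> B\<^sup>2"
    using zero_le_power2[of "enorm N (X 0)"] unfolding diff_zero by linarith
  moreover have "2 * (m - 1) * e * t = B\<^sup>2 + 1" unfolding t_def using m e by simp
  ultimately show False by simp
qed

lemma F_tendsto:
  assumes Z: "ordered N Z" and lim: "\<And>i. i \<in> {1..N} \<Longrightarrow> (\<lambda>n. x n i) \<longlonglongrightarrow> Z i"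
  shows "(\<lambda>n. F (x n)) \<longlonglongrightarrow> F Z"
proof -
  have ne: "Z i \<noteq> Z j" if "i \<in> {1..N}" "j \<in> {1..N} - {i}" for i j
    using ordered_less[OF Z, of i j] ordered_less[OF Z, of j i] that by (auto simp: mem_pairs neq_iff)
  show ?thesis unfolding FNm_def
    by (intro tendsto_diff tendsto_mult tendsto_const tendsto_sum tendsto_powr tendsto_rabs lim)
      (use Z ne in \<open>auto simp: ordered_def\<close>)
qed

text \<open>Boundedness gives a convergent subsequence, and the uniform gap keeps its limit off the
  collision set. The times \<open>T\<close> are arbitrary because convergence of the whole
  trajectory is later tested along bad sequences.\<close>

lemma limit_of_bounded_solution:
  assumes X0: "inRN N X0" and sol: "is_solution N m chi X0 X \<infinity>"
    and B: "\<And>t. 0 \<le> t \<Longrightarrow> enorm N (X t) \<le> B" and T: "filterlim T at_top sequentially" "\<And>n. 0 \<le> T n"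
  shows "\<exists>s Z. strict_mono (s :: nat \<Rightarrow> nat) \<and> inRN N Z \<and> F Z = 0 \<and> (\<forall>i. (\<lambda>n. X (T (s n)) i) \<longlonglongrightarrow> Z i)"
proof -
  obtain d where d: "uniform_gap X0 d" using uniform_gap_exists[OF X0] by blast
  then have d0: "0 < d" by (simp add: uniform_gap_def)
  have bound: "\<bar>X (T n) i\<bar> \<le> B" if "i \<in> {1..N}" for n i
    using abs_le_enorm[OF that, of "X (T n)"] B[OF T(2)[of n]] by linarith
  obtain l and s :: "nat \<Rightarrow> nat" where s: "strict_mono s"
    and l: "\<And>i. i \<in> {1..N} \<Longrightarrow> (\<lambda>n. X (T (s n)) i) \<longlonglongrightarrow> l i"
    using bounded_coordinates_convergent_subsequence[of "{1..N}" "\<lambda>n. X (T n)" B, OF _ bound] by blast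
  define Z where "Z = (\<lambda>i. if i \<in> {1..N} then l i else 0)"
  have XR: "inRN N (X (T n))" for n using is_solution_inRN[OF sol T(2)] by simp
  have Z: "(\<lambda>n. X (T (s n)) i) \<longlonglongrightarrow> Z i" for i
  proof (cases "i \<in> {1..N}")
    case True
    then show ?thesis using l by (simp add: Z_def)
  next
    case False
    then have "X (T n) i = 0" for n using XR by (simp add: inRN_def)
    then show ?thesis using False by (auto simp: Z_def)
  qed
  have gapZ: "d \<le> Z (Suc k) - Z k" if "k \<in> {1..<N}" for k
    by (rule LIMSEQ_le_const[OF tendsto_diff[OF Z Z]])
      (use solution_gap[OF d sol T(2)] that in auto)
  have o: "ordered N Z" unfolding ordered_def
  proof
    fix k assume "k \<in> {1..<N}"
    then show "Z k < Z (Suc k)" using gapZ[of k] d0 by linarith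
  qed
  have "(\<lambda>n. \<Sum>i=1..N. X (T (s n)) i) \<longlonglongrightarrow> (\<Sum>i=1..N. Z i)" by (intro tendsto_sum Z)
  then have "(\<Sum>i=1..N. Z i) = 0" using XR LIMSEQ_unique[OF tendsto_const] by (fastforce simp: inRN_def)
  then have ZR: "inRN N Z" using o by (auto simp: inRN_def ordered_def Z_def)
  have "F Z \<le> 0"
  proof (rule field_le_epsilon)
    fix e :: real assume e: "0 < e"
    obtain t0 where t0: "\<And>t. t0 \<le> t \<Longrightarrow> F (X t) \<le> e" using F_small_of_bounded[OF sol B e] by blast
    have "filterlim (\<lambda>n. T (s n)) at_top sequentially"
      by (rule filterlim_compose[OF T(1) filterlim_subseq[OF s]])
    then have "\<forall>\<^sub>F n in sequentially. F (X (T (s n))) \<le> e"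
      unfolding filterlim_at_top by (auto elim!: allE[of _ t0] eventually_mono intro: t0)
    then show "F Z \<le> 0 + e" using F_tendsto[OF o Z] by (simp add: tendsto_upperbound)
  qed
  then have "F Z = 0" using F_nonneg[OF o] by simp
  then show ?thesis using s ZR Z by blast
qed

lemma unit_zero_unique:
  assumes "inRN N Z" "F Z = 0" "enorm N Z = 1" "inRN N W" "F W = 0" "enorm N W = 1"
  shows "W = Z"
proof -
  obtain c where c: "0 < c" "\<And>i. W i = c * Z i"
    using zeros_of_F_proportional[of Z W] assms by blast
  then have "W = (\<lambda>i. c * Z i)" by auto
  then have "c = 1" using enorm_scale[of c N Z] assms c by simp
  then show ?thesis using c by auto
qed

lemma normalized_zero:
  assumes Z: "inRN N Z" "F Z = 0"
  defines "W \<equiv> \<lambda>i. Z i / enorm N Z"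
  shows "inRN N W" "F W = 0" "enorm N W = 1"
proof -
  have p: "0 < enorm N Z" using enorm_pos[OF N Z(1)] .
  have W: "W = (\<lambda>i. inverse (enorm N Z) * Z i)" by (auto simp: W_def divide_inverse mult.commute)
  show "inRN N W" unfolding W using p Z by (intro inRN_scale) auto
  show "F W = 0" unfolding W using p Z by (subst FNm_scale) auto
  show "enorm N W = 1" unfolding W using p by (subst enorm_scale) auto
qed

lemma normalized_tendsto:
  assumes "inRN N Z" "\<And>i. (\<lambda>n. x n i) \<longlonglongrightarrow> Z i"
  shows "(\<lambda>n. x n i / enorm N (x n)) \<longlonglongrightarrow> Z i / enorm N Z"
proof (rule tendsto_divide[OF assms(2)])
  show "(\<lambda>n. enorm N (x n)) \<longlonglongrightarrow> enorm N Z"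
    unfolding enorm_def by (intro tendsto_intros assms)
  show "enorm N Z \<noteq> 0" using enorm_pos[OF N assms(1)] by simp
qed

text \<open>Limit points of the flow might a priori differ by a dilation; normalisation removes it.
  Every sequence of times thus has a subsequence with the same limit \<open>W\<close>, so no
  sequence can stay away from \<open>W\<close>.\<close>

lemma normalized_solution_converges:
  assumes X0: "inRN N X0" and sol: "is_solution N m chi X0 X \<infinity>"
    and B: "\<And>t. 0 \<le> t \<Longrightarrow> enorm N (X t) \<le> B"
  shows "\<exists>Z. inRN N Z \<and> F Z = 0 \<and> enorm N Z = 1 \<and> (\<forall>i. ((\<lambda>t. X t i / enorm N (X t)) \<longlongrightarrow> Z i) at_top)"
proof -
  \<comment> \<open>Integer times suffice to produce one zero of \<open>F\<close>, whose
    normalisation is the candidate limit.\<close>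
  obtain V where V: "inRN N V" "F V = 0"
    using limit_of_bounded_solution[OF X0 sol B filterlim_real_sequentially] by auto
  define W where "W = (\<lambda>i. V i / enorm N V)"
  note W = normalized_zero[OF V, folded W_def]
  have "((\<lambda>t. X t i / enorm N (X t)) \<longlongrightarrow> W i) at_top" for i
  proof (rule ccontr)
    assume "\<not> ?thesis"
    then obtain e where e: "0 < e" and ne: "\<not> (\<forall>\<^sub>F t in at_top. dist (X t i / enorm N (X t)) (W i) < e)"
      by (auto simp: tendsto_iff)
    have "\<exists>t\<ge>real n. e \<le> dist (X t i / enorm N (X t)) (W i)" for n
      using ne unfolding eventually_at_top_linorder by (meson not_le)
    then obtain T where T: "\<And>n. real n \<le> T n" and Te: "\<And>n. e \<le> dist (X (T n) i / enorm N (X (T n))) (W i)"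
      by metis
    have "filterlim T at_top sequentially"
      by (rule filterlim_at_top_mono[OF filterlim_real_sequentially]) (use T in auto)
    moreover have "0 \<le> T n" for n using T[of n] by (meson of_nat_0_le_iff order_trans)
    ultimately obtain s :: "nat \<Rightarrow> nat" and Z where Z: "inRN N Z" "F Z = 0" "\<And>i. (\<lambda>n. X (T (s n)) i) \<longlonglongrightarrow> Z i"
      using limit_of_bounded_solution[OF X0 sol B] by blast
    have "(\<lambda>i. Z i / enorm N Z) = W"
      by (rule unit_zero_unique[OF W normalized_zero[OF Z(1,2)]])
    then have "Z i / enorm N Z = W i" by metis
    then have "(\<lambda>n. X (T (s n)) i / enorm N (X (T (s n)))) \<longlonglongrightarrow> W i"
      using normalized_tendsto[OF Z(1,3), of i] by simp
    then have "\<forall>\<^sub>F n in sequentially. dist (X (T (s n)) i / enorm N (X (T (s n)))) (W i) < e"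
      using e by (rule tendstoD)
    then show False using Te by (auto simp: eventually_sequentially not_le[symmetric])
  qed
  then show ?thesis using W by blast
qed

text \<open>The global solution from \<open>X0\<close> agrees with \<open>X\<close> wherever
  \<open>X\<close> lives, so a finite lifetime would contradict maximality.\<close>

lemma maximal_solution_global:
  assumes X0: "inRN N X0" and max: "is_maximal_solution N m chi X0 X T"
  shows "T = \<infinity>"
proof (rule ccontr)
  assume "T \<noteq> \<infinity>"
  then have T: "T < \<infinity>" by simp
  have sol: "is_solution N m chi X0 X T" using max by (simp add: is_maximal_solution_def)
  obtain Y where Y: "is_solution N m chi X0 Y \<infinity>" using global_solution_exists[OF X0] by blast
  have "Y t = X t" if "0 \<le> t" "ereal t < T" for t
    by (rule solution_unique[OF X0 Y sol]) (use that in auto)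
  then show False using max T Y unfolding is_maximal_solution_def by blast
qed

lemma maximal_solutions:
  assumes X0: "inRN N X0"
  shows "(\<exists>X. is_maximal_solution N m (CN N m) X0 X \<infinity>)
    \<and> (\<forall>X T. is_maximal_solution N m (CN N m) X0 X T \<longrightarrow>
         T = \<infinity> \<and>
         ((\<exists>B. \<forall>t\<ge>0. enorm N (X t) \<le> B) \<longrightarrow>
           (\<exists>Z. inRN N Z \<and> critical_point N m (CN N m) Z \<and> enorm N Z = 1 \<and>
                (\<forall>Z'. inRN N Z' \<and> critical_point N m (CN N m) Z' \<and> enorm N Z' = 1 \<longrightarrow> Z' = Z) \<and>
                (\<forall>i. ((\<lambda>t. X t i / enorm N (X t)) \<longlongrightarrow> Z i) at_top))))"
proof (intro conjI allI impI)
  obtain X where "is_solution N m (CN N m) X0 X \<infinity>" using global_solution_exists[OF X0] by blast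
  then show "\<exists>X. is_maximal_solution N m (CN N m) X0 X \<infinity>"
    by (auto simp: is_maximal_solution_def)
next
  fix X T assume "is_maximal_solution N m (CN N m) X0 X T"
  then show "T = \<infinity>" by (rule maximal_solution_global[OF X0])
next
  fix X T assume max: "is_maximal_solution N m (CN N m) X0 X T"
    and "\<exists>B. \<forall>t\<ge>0. enorm N (X t) \<le> B"
  then obtain B where B: "\<And>t. 0 \<le> t \<Longrightarrow> enorm N (X t) \<le> B" by blast
  have "is_solution N m (CN N m) X0 X \<infinity>"
    using max maximal_solution_global[OF X0 max] by (simp add: is_maximal_solution_def)
  from normalized_solution_converges[OF X0 this B]
  obtain Z where Z: "inRN N Z" "F Z = 0" "enorm N Z = 1"
    and lim: "\<forall>i. ((\<lambda>t. X t i / enorm N (X t)) \<longlongrightarrow> Z i) at_top" by blast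
  then show "\<exists>Z. inRN N Z \<and> critical_point N m (CN N m) Z \<and> enorm N Z = 1 \<and>
              (\<forall>Z'. inRN N Z' \<and> critical_point N m (CN N m) Z' \<and> enorm N Z' = 1 \<longrightarrow> Z' = Z) \<and>
              (\<forall>i. ((\<lambda>t. X t i / enorm N (X t)) \<longlongrightarrow> Z i) at_top)"
    using unit_zero_unique[OF Z] critical_point_iff by metis
qed

end

theorem theorem1p5:
  fixes N :: nat and m chi :: real and X0 :: "nat \<Rightarrow> real"
  assumes "m > 1" and "N \<ge> 2" and "chi = CN N m" and "inRN N X0"
  shows "(\<exists>X. is_maximal_solution N m chi X0 X \<infinity>)
    \<and> (\<forall>X T. is_maximal_solution N m chi X0 X T \<longrightarrow>
         T = \<infinity> \<and>
         ((\<exists>B. \<forall>t\<ge>0. enorm N (X t) \<le> B) \<longrightarrow>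
           (\<exists>Z. inRN N Z \<and> critical_point N m chi Z \<and> enorm N Z = 1 \<and>
                (\<forall>Z'. inRN N Z' \<and> critical_point N m chi Z' \<and> enorm N Z' = 1 \<longrightarrow> Z' = Z) \<and>
                (\<forall>i. ((\<lambda>t. X t i / enorm N (X t)) \<longlongrightarrow> Z i) at_top))))"
  unfolding \<open>chi = CN N m\<close>
  using critical_gradient_flow.maximal_solutions[OF critical_gradient_flow.intro] assms by blast

end
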